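(* Let $(X,d,f)$ be an irreducible Smale space with totally disconnected local stable sets. Then there exist a compact metric space $(Y,\delta)$ and a continuous surjection $\alpha:Y\to Y$ such that $(Y,\delta,\alpha)$ satisfies Axioms 1 and 2 and $(X,d,f)$ is topologically conjugate to the inverse limit space $(\hat Y,\hat\delta,\hat\alpha)$.
   Context: Smale space: Let $(X,d)$ be a compact metric space and $f:X\to X$ a homeomorphism. For $x\in X$, $\epsilon>0$ put $X^s(x,\epsilon)=\{y\in X : d(f^n(x),f^n(y))\leq\epsilon \ \forall n\geq 0\}$ and $X^u(x,\epsilon)=\{y\in X : d(f^{-n}(x),f^{-n}(y))\leq\epsilon\ \forall n\geq 0\}$ (local stable and unstable sets). $(X,d,f)$ is a Smale space if there are constants $\epsilon_X>0$, $\epsilon_X'>0$, $0<\lambda<1$ such that (1) for all $x\in X$, $n\geq 0$: $d(f^n(y),f^n(z))\leq\lambda^n d(y,z)$ if $y,z\in X^s(x,\epsilon_X')$; (2) for all $x\in X$, $n\ge 0$: $d(f^{-n}(y),f^{-n}(z))\leq\lambda^n d(y,z)$ if $y,z\in X^u(x,\epsilon_X')$; (3) if $d(x,y)\leq\epsilon_X$ then $X^s(x,\epsilon_X')\cap X^u(y,\epsilon_X')$ consists of a single point, denoted $[x,y]$. It has totally disconnected local stable sets if (for such constants) $X^s(x,\epsilon)$ is totally disconnected for every $x\in X$ and $0<\epsilon\leq\epsilon_X$. It is irreducible if it is non-wandering (for every non-empty open $U$ there is $n\geq 1$ with $f^n(U)\cap U\neq\varnothing$) and has a dense orbit. Axioms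 1 and 2: $B(x,r)$ denotes the closed ball. For a compact metric space $(Y,\delta)$ and continuous surjective $\alpha:Y\to Y$, $(Y,\delta,\alpha)$ satisfies Axioms 1 and 2 if there exist $\beta>0$, an integer $K\geq 1$ and $0<\gamma<1$ such that: Axiom 1: if $\delta(x,y)\leq\beta$ then $\delta(\alpha^K(x),\alpha^K(y))\leq\gamma^K \delta(\alpha^{2K}(x),\alpha^{2K}(y))$; Axiom 2: for all $x\in Y$ and $0<\epsilon\leq\beta$, $\alpha^K(B(\alpha^K(x),\epsilon))\subseteq \alpha^{2K}(B(x,\gamma\epsilon))$. Inverse limit: $\hat Y=\{(y_0,y_1,y_2,\dots) : y_n\in Y,\ y_n=\alpha(y_{n+1})\ \forall n\geq 0\}$, $\hat\alpha(y_0,y_1,\dots)=(\alpha(y_0),\alpha(y_1),\dots)=(\alpha(y_0),y_0,y_1,\dots)$, $\delta'(\mathbf x,\mathbf y)=\sup_{n\geq 0}\gamma^n \delta(x_n,y_n)$, and $\hat \delta(\mathbf x,\mathbf y)=\sum_{k=0}^{K-1}\gamma^{-k}\delta'(\hat \alpha^{-k}(\mathbf x),\hat \alpha^{-k}(\mathbf y))$, which induces the product topology. Topologically conjugate means there is a homeomorphism $\omega:X\to\hat Y$ with $\omega\circ f=\hat\alpha\circ\omega$. *)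

theory Defs
  imports "HOL-Analysis.Analysis"
begin

definition compact_metric :: "'a set \<Rightarrow> ('a \<Rightarrow> 'a \<Rightarrow> real) \<Rightarrow> bool" where
  "compact_metric M d \<longleftrightarrow>
     Metric_space M d \<and> compact_space (Metric_space.mtopology M d)"


section \<open>Smale spaces\<close>

text \<open>For a bijection \<open>f\<close> of \<open>X\<close>, the negative iterate \<open>f\<^sup>-\<^sup>n\<close> on \<open>X\<close> is
  \<open>inv_into X f ^^ n\<close>.\<close>

definition local_stable ::
  "'a set \<Rightarrow> ('a \<Rightarrow> 'a \<Rightarrow> real) \<Rightarrow> ('a \<Rightarrow> 'a) \<Rightarrow> 'a \<Rightarrow> real \<Rightarrow> 'a set" where
  "local_stable X d f x \<epsilon> = {y \<in> X. \<forall>n. d ((f ^^ n) x) ((f ^^ n) y) \<le> \<epsilon>}"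

definition local_unstable ::
  "'a set \<Rightarrow> ('a \<Rightarrow> 'a \<Rightarrow> real) \<Rightarrow> ('a \<Rightarrow> 'a) \<Rightarrow> 'a \<Rightarrow> real \<Rightarrow> 'a set" where
  "local_unstable X d f x \<epsilon> =
     {y \<in> X. \<forall>n. d ((inv_into X f ^^ n) x) ((inv_into X f ^^ n) y) \<le> \<epsilon>}"

text \<open>The constants \<open>\<epsilon>\<^sub>X\<close>, \<open>\<epsilon>\<^sub>X'\<close>, \<open>\<lambda>\<close> are the parameters \<open>e\<close>, \<open>e'\<close>, \<open>l\<close>.\<close>

definition smale_space ::
  "'a set \<Rightarrow> ('a \<Rightarrow> 'a \<Rightarrow> real) \<Rightarrow> ('a \<Rightarrow> 'a) \<Rightarrow> real \<Rightarrow> real \<Rightarrow> real \<Rightarrow> bool" where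
  "smale_space X d f e e' l \<longleftrightarrow>
     compact_metric X d \<and>
     homeomorphic_map (Metric_space.mtopology X d) (Metric_space.mtopology X d) f \<and>
     0 < e \<and> 0 < e' \<and> 0 < l \<and> l < 1 \<and>
     (\<forall>x\<in>X. \<forall>n. \<forall>y \<in> local_stable X d f x e'. \<forall>z \<in> local_stable X d f x e'.
        d ((f ^^ n) y) ((f ^^ n) z) \<le> l ^ n * d y z) \<and>
     (\<forall>x\<in>X. \<forall>n. \<forall>y \<in> local_unstable X d f x e'. \<forall>z \<in> local_unstable X d f x e'.
        d ((inv_into X f ^^ n) y) ((inv_into X f ^^ n) z) \<le> l ^ n * d y z) \<and>
     (\<forall>x\<in>X. \<forall>y\<in>X. d x y \<le> e \<longrightarrow>
        (\<exists>z. local_stable X d f x e' \<inter> local_unstable X d f y e' = {z}))"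

definition totally_disconnectedin :: "'a topology \<Rightarrow> 'a set \<Rightarrow> bool" where
  "totally_disconnectedin T S \<longleftrightarrow>
     S \<subseteq> topspace T \<and> (\<forall>C. connectedin T C \<and> C \<subseteq> S \<longrightarrow> (\<exists>a. C \<subseteq> {a}))"

definition totally_disconnected_local_stable ::
  "'a set \<Rightarrow> ('a \<Rightarrow> 'a \<Rightarrow> real) \<Rightarrow> ('a \<Rightarrow> 'a) \<Rightarrow> real \<Rightarrow> bool" where
  "totally_disconnected_local_stable X d f e \<longleftrightarrow>
     (\<forall>x\<in>X. \<forall>\<epsilon>. 0 < \<epsilon> \<and> \<epsilon> \<le> e \<longrightarrow>
        totally_disconnectedin (Metric_space.mtopology X d) (local_stable X d f x \<epsilon>))"

definition non_wandering :: "'a topology \<Rightarrow> ('a \<Rightarrow> 'a) \<Rightarrow> bool" where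
  "non_wandering T f \<longleftrightarrow>
     (\<forall>U. openin T U \<and> U \<noteq> {} \<longrightarrow> (\<exists>n\<ge>1. (f ^^ n) ` U \<inter> U \<noteq> {}))"

text \<open>Since \<open>f\<close> is invertible, the orbit of a point is its two-sided orbit.\<close>

definition full_orbit :: "'a set \<Rightarrow> ('a \<Rightarrow> 'a) \<Rightarrow> 'a \<Rightarrow> 'a set" where
  "full_orbit X f x = range (\<lambda>n. (f ^^ n) x) \<union> range (\<lambda>n. (inv_into X f ^^ n) x)"

definition irreducible_system :: "'a set \<Rightarrow> ('a \<Rightarrow> 'a \<Rightarrow> real) \<Rightarrow> ('a \<Rightarrow> 'a) \<Rightarrow> bool" where
  "irreducible_system X d f \<longleftrightarrow>
     non_wandering (Metric_space.mtopology X d) f \<and>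
     (\<exists>x\<in>X. Metric_space.mtopology X d closure_of full_orbit X f x = X)"


section \<open>Axioms 1 and 2\<close>

definition axiom1 ::
  "'b set \<Rightarrow> ('b \<Rightarrow> 'b \<Rightarrow> real) \<Rightarrow> ('b \<Rightarrow> 'b) \<Rightarrow> real \<Rightarrow> nat \<Rightarrow> real \<Rightarrow> bool" where
  "axiom1 Y \<delta> \<alpha> \<beta> K \<gamma> \<longleftrightarrow>
     (\<forall>x\<in>Y. \<forall>y\<in>Y. \<delta> x y \<le> \<beta> \<longrightarrow>
        \<delta> ((\<alpha> ^^ K) x) ((\<alpha> ^^ K) y) \<le> \<gamma> ^ K * \<delta> ((\<alpha> ^^ (2 * K)) x) ((\<alpha> ^^ (2 * K)) y))"

definition axiom2 ::
  "'b set \<Rightarrow> ('b \<Rightarrow> 'b \<Rightarrow> real) \<Rightarrow> ('b \<Rightarrow> 'b) \<Rightarrow> real \<Rightarrow> nat \<Rightarrow> real \<Rightarrow> bool" where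
  "axiom2 Y \<delta> \<alpha> \<beta> K \<gamma> \<longleftrightarrow>
     (\<forall>x\<in>Y. \<forall>\<epsilon>. 0 < \<epsilon> \<and> \<epsilon> \<le> \<beta> \<longrightarrow>
        (\<alpha> ^^ K) ` Metric_space.mcball Y \<delta> ((\<alpha> ^^ K) x) \<epsilon>
          \<subseteq> (\<alpha> ^^ (2 * K)) ` Metric_space.mcball Y \<delta> x (\<gamma> * \<epsilon>))"

definition satisfies_axioms ::
  "'b set \<Rightarrow> ('b \<Rightarrow> 'b \<Rightarrow> real) \<Rightarrow> ('b \<Rightarrow> 'b) \<Rightarrow> real \<Rightarrow> nat \<Rightarrow> real \<Rightarrow> bool" where
  "satisfies_axioms Y \<delta> \<alpha> \<beta> K \<gamma> \<longleftrightarrow>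
     0 < \<beta> \<and> 1 \<le> K \<and> 0 < \<gamma> \<and> \<gamma> < 1 \<and> axiom1 Y \<delta> \<alpha> \<beta> K \<gamma> \<and> axiom2 Y \<delta> \<alpha> \<beta> K \<gamma>"


section \<open>Inverse limits\<close>

definition inverse_limit :: "'b set \<Rightarrow> ('b \<Rightarrow> 'b) \<Rightarrow> (nat \<Rightarrow> 'b) set" where
  "inverse_limit Y \<alpha> = {y. \<forall>n. y n \<in> Y \<and> y n = \<alpha> (y (Suc n))}"

definition inverse_limit_map :: "('b \<Rightarrow> 'b) \<Rightarrow> (nat \<Rightarrow> 'b) \<Rightarrow> (nat \<Rightarrow> 'b)" where
  "inverse_limit_map \<alpha> y = (\<lambda>n. \<alpha> (y n))"

text \<open>The metric \<open>\<delta>'\<close> is set to 0 off the inverse limit: \<^locale>\<open>Metric_space\<close> requires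
  nonnegativity on the whole type, where the supremum need not exist.\<close>

definition inverse_limit_predist ::
  "'b set \<Rightarrow> ('b \<Rightarrow> 'b \<Rightarrow> real) \<Rightarrow> ('b \<Rightarrow> 'b) \<Rightarrow> real \<Rightarrow> (nat \<Rightarrow> 'b) \<Rightarrow> (nat \<Rightarrow> 'b) \<Rightarrow> real" where
  "inverse_limit_predist Y \<delta> \<alpha> \<gamma> x y =
     (if x \<in> inverse_limit Y \<alpha> \<and> y \<in> inverse_limit Y \<alpha>
      then (SUP n. \<gamma> ^ n * \<delta> (x n) (y n)) else 0)"

definition inverse_limit_dist ::
  "'b set \<Rightarrow> ('b \<Rightarrow> 'b \<Rightarrow> real) \<Rightarrow> ('b \<Rightarrow> 'b) \<Rightarrow> nat \<Rightarrow> real \<Rightarrow> (nat \<Rightarrow> 'b) \<Rightarrow> (nat \<Rightarrow> 'b) \<Rightarrow> real" where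
  "inverse_limit_dist Y \<delta> \<alpha> K \<gamma> x y =
     (\<Sum>k<K. inverse \<gamma> ^ k *
        inverse_limit_predist Y \<delta> \<alpha> \<gamma>
          ((inv_into (inverse_limit Y \<alpha>) (inverse_limit_map \<alpha>) ^^ k) x)
          ((inv_into (inverse_limit Y \<alpha>) (inverse_limit_map \<alpha>) ^^ k) y))"

definition topologically_conjugate ::
  "'a topology \<Rightarrow> ('a \<Rightarrow> 'a) \<Rightarrow> 'b topology \<Rightarrow> ('b \<Rightarrow> 'b) \<Rightarrow> bool" where
  "topologically_conjugate S f T g \<longleftrightarrow>
     (\<exists>\<omega>. homeomorphic_map S T \<omega> \<and> (\<forall>x\<in>topspace S. \<omega> (f x) = g (\<omega> x)))"


section \<open>The inverse limit metric is a metric\<close>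

lemma inverse_limit_map_bij:
  assumes "\<alpha> ` Y = Y"
  shows "bij_betw (inverse_limit_map \<alpha>) (inverse_limit Y \<alpha>) (inverse_limit Y \<alpha>)"
proof (rule bij_betw_byWitness[where f' = "\<lambda>y n. y (Suc n)"])
  have L: "y n \<in> Y" "\<alpha> (y (Suc n)) = y n" if "y \<in> inverse_limit Y \<alpha>" for y n
    using that unfolding inverse_limit_def by (blast, metis (mono_tags, lifting) mem_Collect_eq)
  show "inverse_limit_map \<alpha> ` inverse_limit Y \<alpha> \<subseteq> inverse_limit Y \<alpha>"
  proof (rule image_subsetI)
    fix y assume y: "y \<in> inverse_limit Y \<alpha>"
    show "inverse_limit_map \<alpha> y \<in> inverse_limit Y \<alpha>"
      using assms L[OF y] by (auto simp: inverse_limit_def[of Y \<alpha>] inverse_limit_map_def)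
  qed
  show "(\<lambda>y n. y (Suc n)) ` inverse_limit Y \<alpha> \<subseteq> inverse_limit Y \<alpha>"
    unfolding inverse_limit_def by blast
  show "\<forall>y\<in>inverse_limit Y \<alpha>. (\<lambda>n. inverse_limit_map \<alpha> y (Suc n)) = y"
    and "\<forall>y\<in>inverse_limit Y \<alpha>. inverse_limit_map \<alpha> (\<lambda>n. y (Suc n)) = y"
    by (simp_all add: L inverse_limit_map_def)
qed

lemma inverse_limit_dist_metric:
  assumes Y: "compact_metric Y \<delta>" and \<alpha>: "\<alpha> ` Y = Y" and K: "1 \<le> K" and \<gamma>: "0 < \<gamma>" "\<gamma> < 1"
  shows "Metric_space (inverse_limit Y \<alpha>) (inverse_limit_dist Y \<delta> \<alpha> K \<gamma>)"
proof -
  interpret Y: Metric_space Y \<delta>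
    using Y by (simp add: compact_metric_def)
  let ?L = "inverse_limit Y \<alpha>"
  let ?p = "inverse_limit_predist Y \<delta> \<alpha> \<gamma>"
  let ?g = "inv_into ?L (inverse_limit_map \<alpha>)"
  have "Y.mbounded Y"
    using Y Y.compactin_imp_mbounded[of Y]
    by (simp add: compact_metric_def compact_space_def)
  then have "\<exists>B. \<forall>x\<in>Y. \<forall>y\<in>Y. \<delta> x y \<le> B"
    by (simp only: Y.mbounded_alt)
  then obtain B where "\<forall>x\<in>Y. \<forall>y\<in>Y. \<delta> x y \<le> B" ..
  then have B: "\<delta> x y \<le> B" if "x \<in> Y" "y \<in> Y" for x y
    using that by simp
  have LY: "x n \<in> Y" if "x \<in> ?L" for x n
    using that unfolding inverse_limit_def by blast
  have bdd: "bdd_above (range (\<lambda>n. \<gamma> ^ n * \<delta> (x n) (y n)))" if "x \<in> ?L" "y \<in> ?L" for x y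
  proof (rule bdd_aboveI2)
    fix n
    have "\<gamma> ^ n * \<delta> (x n) (y n) \<le> 1 * \<delta> (x n) (y n)"
      using \<gamma> by (intro mult_right_mono power_le_one) auto
    also have "\<dots> \<le> B"
      using B LY that by simp
    finally show "\<gamma> ^ n * \<delta> (x n) (y n) \<le> B" .
  qed
  have le_p: "\<gamma> ^ n * \<delta> (x n) (y n) \<le> ?p x y" if "x \<in> ?L" "y \<in> ?L" for x y n
    using cSUP_upper[OF UNIV_I bdd[OF that]] that by (simp add: inverse_limit_predist_def)
  have p_nonneg: "0 \<le> ?p x y" for x y
  proof (cases "x \<in> ?L \<and> y \<in> ?L")
    case True
    then show ?thesis
      using le_p[of x y 0] order_trans[OF Y.nonneg[of "x 0" "y 0"]] by simp
  next
    case False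
    then show ?thesis
      by (auto simp: inverse_limit_predist_def)
  qed
  have p_sym: "?p x y = ?p y x" for x y
    by (auto simp: inverse_limit_predist_def Y.commute)
  have p_refl: "?p x x = 0" for x
    using LY by (auto simp: inverse_limit_predist_def)
  have p_tri: "?p x z \<le> ?p x y + ?p y z" if L: "x \<in> ?L" "y \<in> ?L" "z \<in> ?L" for x y z
  proof -
    have "(SUP n. \<gamma> ^ n * \<delta> (x n) (z n)) \<le> ?p x y + ?p y z"
    proof (rule cSUP_least)
      fix n
      have "\<gamma> ^ n * \<delta> (x n) (z n) \<le> \<gamma> ^ n * (\<delta> (x n) (y n) + \<delta> (y n) (z n))"
        using \<gamma> L LY by (intro mult_left_mono Y.triangle) auto
      also have "\<dots> \<le> ?p x y + ?p y z"
        using le_p[of x y n] le_p[of y z n] L by (simp add: distrib_left)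
      finally show "\<gamma> ^ n * \<delta> (x n) (z n) \<le> ?p x y + ?p y z" .
    qed simp
    then show ?thesis
      using L by (simp add: inverse_limit_predist_def)
  qed
  have "?g ` ?L = ?L"
    using bij_betw_inv_into[OF inverse_limit_map_bij[OF \<alpha>]] by (simp add: bij_betw_def)
  then have g1: "?g x \<in> ?L" if "x \<in> ?L" for x
    using that by blast
  have gL: "(?g ^^ k) x \<in> ?L" if "x \<in> ?L" for k x
    using that by (induction k) (simp_all add: g1)
  show ?thesis
  proof
    show "0 \<le> inverse_limit_dist Y \<delta> \<alpha> K \<gamma> x y" for x y
      using \<gamma> p_nonneg by (auto simp: inverse_limit_dist_def intro!: sum_nonneg mult_nonneg_nonneg)
    show "inverse_limit_dist Y \<delta> \<alpha> K \<gamma> x y = inverse_limit_dist Y \<delta> \<alpha> K \<gamma> y x" for x y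
      unfolding inverse_limit_dist_def by (rule sum.cong[OF refl]) (metis p_sym)
    show "inverse_limit_dist Y \<delta> \<alpha> K \<gamma> x z
        \<le> inverse_limit_dist Y \<delta> \<alpha> K \<gamma> x y + inverse_limit_dist Y \<delta> \<alpha> K \<gamma> y z"
      if "x \<in> ?L" "y \<in> ?L" "z \<in> ?L" for x y z
      unfolding inverse_limit_dist_def sum.distrib[symmetric] distrib_left[symmetric]
      using \<gamma> that by (intro sum_mono mult_left_mono p_tri gL) auto
    show "inverse_limit_dist Y \<delta> \<alpha> K \<gamma> x y = 0 \<longleftrightarrow> x = y" if L: "x \<in> ?L" "y \<in> ?L" for x y
    proof
      assume 0: "inverse_limit_dist Y \<delta> \<alpha> K \<gamma> x y = 0"
      have "\<forall>k\<in>{..<K}. inverse \<gamma> ^ k * ?p ((?g ^^ k) x) ((?g ^^ k) y) = 0"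
        using 0 \<gamma> p_nonneg unfolding inverse_limit_dist_def
        by (subst (asm) sum_nonneg_eq_0_iff) (auto intro!: mult_nonneg_nonneg)
      then have p0: "?p x y = 0"
        using K by (auto dest: bspec[where x = 0])
      have "\<delta> (x n) (y n) = 0" for n
      proof -
        have "\<gamma> ^ n * \<delta> (x n) (y n) \<le> 0" and "0 < \<gamma> ^ n"
          using le_p[OF L, of n] p0 \<gamma> by auto
        then have "\<delta> (x n) (y n) \<le> 0"
          by (simp add: mult_le_0_iff)
        then show ?thesis
          using Y.nonneg[of "x n" "y n"] by linarith
      qed
      then show "x = y"
        using L LY by (auto simp: fun_eq_iff)
    qed (simp add: inverse_limit_dist_def p_refl)
  qed
qed

end

theory Submission
  imports Defs
begin

text \<open>Total disconnectedness of the stable sets provides, around every point \<open>a\<close>, a continuous bump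
  function that measures the unstable coordinate of \<open>x\<close> relative to \<open>a\<close> and is cut off by a clopen
  condition on the stable coordinate; it is therefore constant on stable sets of a small size.
  Finitely many bumps give a pseudometric \<open>g\<close> that ignores small stable displacements but separates
  distant points. The space \<open>Y\<close> is the quotient of \<open>X\<close> by the pseudometric
  \<open>D x y = (SUP n. l ^ n * g (f\<^sup>n x) (f\<^sup>n y))\<close>, whose classes are contained in local stable sets. By
  its definition \<open>D\<close> is expanded by \<open>f\<close> at most by the factor \<open>1 / l\<close>, and along unstable sets \<open>D\<close> is
  comparable to \<open>l\<close> raised to the time of separation, so that \<open>f\<^sup>n\<close> expands it there by \<open>l\<^sup>-\<^sup>n\<close> up to a
  constant. For large \<open>K\<close>, two points that are close for \<open>D\<close> have images under \<open>f\<^sup>K\<close> that can be moved,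
  within their classes, into a common local unstable set, and both axioms follow with
  \<open>\<gamma> = sqrt l\<close>. The conjugacy sends \<open>x\<close> to the sequence of the classes of \<open>f\<^sup>-\<^sup>n x\<close>.\<close>

section \<open>Compact metric spaces\<close>

context Metric_space
begin

lemma dist_tendsto:
  assumes "\<And>n. u n \<in> M" "\<And>n. v n \<in> M" "x \<in> M" "y \<in> M"
    and "(\<lambda>n. d (u n) x) \<longlonglongrightarrow> 0" "(\<lambda>n. d (v n) y) \<longlonglongrightarrow> 0"
  shows "(\<lambda>n. d (u n) (v n)) \<longlonglongrightarrow> d x y"
proof (rule LIM_zero_cancel, rule Lim_null_comparison)
  show "\<forall>\<^sub>F n in sequentially. norm (d (u n) (v n) - d x y) \<le> d (u n) x + d (v n) y"
  proof (intro always_eventually allI)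
    fix n
    have "d (u n) (v n) \<le> d (u n) x + d x y + d (v n) y"
      using triangle[of "u n" x "v n"] triangle[of x y "v n"] commute[of "v n" y] assms by fastforce
    moreover have "d x y \<le> d (u n) x + d (u n) (v n) + d (v n) y"
      using triangle[of x "u n" y] triangle[of "u n" "v n" y] commute[of "u n" x] assms by fastforce
    ultimately show "norm (d (u n) (v n) - d x y) \<le> d (u n) x + d (v n) y"
      by (simp add: abs_le_iff)
  qed
  show "(\<lambda>n. d (u n) x + d (v n) y) \<longlonglongrightarrow> 0"
    using tendsto_add[OF assms(5,6)] by simp
qed

lemma compact_subseq:
  assumes "compact_space mtopology" and "\<And>n. u n \<in> M"
  obtains x r where "x \<in> M" "strict_mono (r :: nat \<Rightarrow> nat)" "(\<lambda>n. d (u (r n)) x) \<longlonglongrightarrow> 0"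
proof -
  have "range u \<subseteq> M"
    using assms(2) by auto
  then obtain x r where "x \<in> M" "strict_mono (r :: nat \<Rightarrow> nat)" "limitin mtopology (u \<circ> r) x sequentially"
    using assms(1) unfolding compact_space_sequentially by blast
  then show ?thesis
    using that by (auto simp: limitin_metric_dist_null)
qed

lemma compact_subseq2:
  assumes "compact_space mtopology" and "\<And>n. u n \<in> M" "\<And>n. v n \<in> M"
  obtains x y r where "x \<in> M" "y \<in> M" "strict_mono (r :: nat \<Rightarrow> nat)"
    "(\<lambda>n. d (u (r n)) x) \<longlonglongrightarrow> 0" "(\<lambda>n. d (v (r n)) y) \<longlonglongrightarrow> 0"
proof -
  obtain x r where x: "x \<in> M" "strict_mono (r :: nat \<Rightarrow> nat)" "(\<lambda>n. d (u (r n)) x) \<longlonglongrightarrow> 0"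
    by (rule compact_subseq[OF assms(1,2)])
  obtain y s where y: "y \<in> M" "strict_mono (s :: nat \<Rightarrow> nat)" "(\<lambda>n. d (v (r (s n))) y) \<longlonglongrightarrow> 0"
    by (rule compact_subseq[OF assms(1), of "\<lambda>n. v (r n)"]) (use assms(3) in auto)
  show ?thesis
    using that[of x y "r \<circ> s"] x y strict_mono_o[OF x(2) y(2)] LIMSEQ_subseq_LIMSEQ[OF x(3) y(2)]
    by (simp add: o_def)
qed

lemma continuous_funpow:
  assumes "continuous_map mtopology mtopology h"
  shows "continuous_map mtopology mtopology (h ^^ k)"
proof (induction k)
  case (Suc k)
  then show ?case
    using continuous_map_compose[OF Suc assms] by (simp add: o_def)
qed (simp add: id_def)

lemma tendsto_image:
  assumes "continuous_map mtopology mtopology h" "x \<in> M" "\<And>n. u n \<in> M" "(\<lambda>n. d (u n) x) \<longlonglongrightarrow> 0"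
  shows "(\<lambda>n. d (h (u n)) (h x)) \<longlonglongrightarrow> 0"
proof -
  have "limitin mtopology u x sequentially"
    using assms by (simp add: limitin_metric_dist_null)
  from continuous_map_limit[OF assms(1) this] show ?thesis
    by (simp add: limitin_metric_dist_null o_def)
qed

text \<open>Compactness makes each iterate uniformly continuous, and the finitely many moduli for
  \<open>j \<le> K\<close> have a positive minimum.\<close>

lemma uniform_funpow:
  assumes "compact_space mtopology" "continuous_map mtopology mtopology h" "0 < \<epsilon>"
  obtains \<delta> where "0 < \<delta>" "\<And>x y j. \<lbrakk>x \<in> M; y \<in> M; d x y \<le> \<delta>; j \<le> K\<rbrakk> \<Longrightarrow> d ((h ^^ j) x) ((h ^^ j) y) \<le> \<epsilon>"
proof -
  have "\<exists>\<delta>>0. \<forall>x\<in>M. \<forall>y\<in>M. d x y < \<delta> \<longrightarrow> d ((h ^^ j) x) ((h ^^ j) y) < \<epsilon>" for j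
  proof -
    have "uniformly_continuous_map (metric (M,d)) (metric (M,d)) (h ^^ j)"
      using assms(1) continuous_funpow[OF assms(2)]
      by (intro continuous_imp_uniformly_continuous_map) (simp add: mtopology_of)
    then show ?thesis
      using assms(3) unfolding uniformly_continuous_map_def by (simp add: commute)
  qed
  then obtain \<delta> where \<delta>: "\<And>j. 0 < \<delta> j"
    "\<And>j x y. \<lbrakk>x \<in> M; y \<in> M; d x y < \<delta> j\<rbrakk> \<Longrightarrow> d ((h ^^ j) x) ((h ^^ j) y) < \<epsilon>"
    by metis
  show ?thesis
  \<comment> \<open>Half the minimum, because the moduli ask for strict inequalities while the bound
    on \<open>d x y\<close> here is not strict.\<close>
  proof (rule that[of "Min (\<delta> ` {..K}) / 2"])
    have M: "0 < Min (\<delta> ` {..K})"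
      using \<delta>(1) by (subst Min_gr_iff) auto
    then show "0 < Min (\<delta> ` {..K}) / 2"
      by simp
    fix x y j
    assume xy: "x \<in> M" "y \<in> M" "d x y \<le> Min (\<delta> ` {..K}) / 2" and "j \<le> K"
    then have "Min (\<delta> ` {..K}) \<le> \<delta> j"
      by (intro Min_le) auto
    then have "d x y < \<delta> j"
      using xy M by linarith
    then show "d ((h ^^ j) x) ((h ^^ j) y) \<le> \<epsilon>"
      using \<delta>(2)[OF xy(1,2)] less_imp_le by blast
  qed
qed

end

lemma le_limit:
  fixes u :: "nat \<Rightarrow> real"
  assumes "u \<longlonglongrightarrow> a" "\<And>n. u n \<le> c"
  shows "a \<le> c"
  using assms LIMSEQ_le_const2 by blast

text \<open>Serves the compactness arguments below: if no uniform constant exists, counterexamples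
  to the constants \<open>inverse (real (Suc k))\<close> form a sequence whose defect tends to
  0.\<close>

lemma tendsto_0_le_inverse_Suc:
  fixes a :: "nat \<Rightarrow> real"
  assumes "\<And>k. 0 \<le> a k" "\<And>k. a k \<le> inverse (real (Suc k))"
  shows "a \<longlonglongrightarrow> 0"
  using tendsto_sandwich[of "\<lambda>_. 0" a sequentially "\<lambda>k. inverse (real (Suc k))" 0] assms
    LIMSEQ_inverse_real_of_nat by auto

section \<open>Local product structure\<close>

locale smale =
  fixes X :: "'a set" and d :: "'a \<Rightarrow> 'a \<Rightarrow> real" and f :: "'a \<Rightarrow> 'a" and e e' l :: real
  assumes smale: "smale_space X d f e e' l"
begin

sublocale Metric_space X d
  using smale by (simp add: smale_space_def compact_metric_def)

abbreviation "F \<equiv> inv_into X f"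
abbreviation "S \<equiv> local_stable X d f"
abbreviation "U \<equiv> local_unstable X d f"

section \<open>Iterates of the homeomorphism and of its inverse\<close>

lemma compact: "compact_space mtopology"
  using smale by (simp add: smale_space_def compact_metric_def)

lemma homeo: "homeomorphic_map mtopology mtopology f"
  using smale by (simp add: smale_space_def)

lemma const_bounds: "0 < e" "0 < e'" "0 < l" "l < 1"
  using smale by (auto simp: smale_space_def)

lemma bij: "bij_betw f X X"
  using homeomorphic_imp_injective_map[OF homeo] homeomorphic_imp_surjective_map[OF homeo]
  by (simp add: bij_betw_def)

lemma f_in[simp]: "x \<in> X \<Longrightarrow> f x \<in> X"
  using bij by (auto simp: bij_betw_def)

lemma F_in[simp]: "x \<in> X \<Longrightarrow> F x \<in> X"
  using bij by (metis bij_betw_def inv_into_into)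

lemma fF[simp]: "x \<in> X \<Longrightarrow> f (F x) = x"
  using bij by (metis bij_betw_def f_inv_into_f)

lemma Ff[simp]: "x \<in> X \<Longrightarrow> F (f x) = x"
  using bij by (simp add: bij_betw_def inv_into_f_f)

lemma fn_in[simp]: "x \<in> X \<Longrightarrow> (f ^^ n) x \<in> X"
  by (induction n) auto

lemma Fn_in[simp]: "x \<in> X \<Longrightarrow> (F ^^ n) x \<in> X"
  by (induction n) auto

lemma Fn_fn[simp]: "x \<in> X \<Longrightarrow> (F ^^ n) ((f ^^ n) x) = x"
proof (induction n)
  case (Suc n)
  then show ?case
    unfolding funpow_Suc_right[of n F] by simp
qed simp

lemma fn_Fn[simp]: "x \<in> X \<Longrightarrow> (f ^^ n) ((F ^^ n) x) = x"
proof (induction n)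
  case (Suc n)
  then show ?case
    unfolding funpow_Suc_right[of n f] by simp
qed simp

lemma Fm_fn:
  assumes "x \<in> X"
  shows "m \<le> n \<Longrightarrow> (F ^^ m) ((f ^^ n) x) = (f ^^ (n - m)) x"
    and "n \<le> m \<Longrightarrow> (F ^^ m) ((f ^^ n) x) = (F ^^ (m - n)) x"
proof -
  assume "m \<le> n"
  then have "(f ^^ n) x = (f ^^ m) ((f ^^ (n - m)) x)"
    using funpow_add[of m "n - m" f] by simp
  then show "(F ^^ m) ((f ^^ n) x) = (f ^^ (n - m)) x"
    using assms by simp
next
  assume "n \<le> m"
  then have "(F ^^ m) ((f ^^ n) x) = (F ^^ (m - n)) ((F ^^ n) ((f ^^ n) x))"
    using funpow_add[of "m - n" n F] by simp
  then show "(F ^^ m) ((f ^^ n) x) = (F ^^ (m - n)) x"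
    using assms by simp
qed

lemma fm_Fn:
  assumes "x \<in> X" "m \<le> n"
  shows "(f ^^ m) ((F ^^ n) x) = (F ^^ (n - m)) x"
proof -
  have "(F ^^ n) x = (F ^^ m) ((F ^^ (n - m)) x)"
    using funpow_add[of m "n - m" F] assms(2) by simp
  then show ?thesis
    using assms by simp
qed

lemma continuous_f: "continuous_map mtopology mtopology f"
  by (rule homeomorphic_imp_continuous_map[OF homeo])

lemma continuous_F: "continuous_map mtopology mtopology F"
proof -
  obtain g where g: "homeomorphic_maps mtopology mtopology f g"
    using homeo homeomorphic_map_maps by blast
  have "F x = g x" if "x \<in> X" for x
    by (metis Ff g homeomorphic_maps_def bij topspace_mtopology bij_betw_def imageE that)
  moreover have "continuous_map mtopology mtopology g"
    using g by (simp add: homeomorphic_maps_def)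
  ultimately show ?thesis
    using continuous_map_eq[of mtopology mtopology g F] by simp
qed

lemmas tendsto_f = tendsto_image[OF continuous_funpow[OF continuous_f]]
lemmas tendsto_F = tendsto_image[OF continuous_funpow[OF continuous_F]]
lemmas uniform_f = uniform_funpow[OF compact continuous_f]
lemmas uniform_F = uniform_funpow[OF compact continuous_F]

section \<open>Elementary properties of local stable and unstable sets\<close>

lemma S_in: "y \<in> S x r \<Longrightarrow> y \<in> X"
  by (simp add: local_stable_def)

lemma U_in: "y \<in> U x r \<Longrightarrow> y \<in> X"
  by (simp add: local_unstable_def)

lemma S_dist: "y \<in> S x r \<Longrightarrow> d ((f ^^ n) x) ((f ^^ n) y) \<le> r"
  by (simp add: local_stable_def)

lemma U_dist: "y \<in> U x r \<Longrightarrow> d ((F ^^ n) x) ((F ^^ n) y) \<le> r"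
  by (simp add: local_unstable_def)

lemma S_dist0: "y \<in> S x r \<Longrightarrow> d x y \<le> r"
  using S_dist[of y x r 0] by simp

lemma U_dist0: "y \<in> U x r \<Longrightarrow> d x y \<le> r"
  using U_dist[of y x r 0] by simp

lemma S_self: "\<lbrakk>x \<in> X; 0 \<le> r\<rbrakk> \<Longrightarrow> x \<in> S x r"
  by (simp add: local_stable_def)

lemma U_self: "\<lbrakk>x \<in> X; 0 \<le> r\<rbrakk> \<Longrightarrow> x \<in> U x r"
  by (simp add: local_unstable_def)

lemma S_sym: "\<lbrakk>x \<in> X; y \<in> S x r\<rbrakk> \<Longrightarrow> x \<in> S y r"
  by (simp add: local_stable_def commute)

lemma U_sym: "\<lbrakk>x \<in> X; y \<in> U x r\<rbrakk> \<Longrightarrow> x \<in> U y r"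
  by (simp add: local_unstable_def commute)

lemma S_mono: "\<lbrakk>y \<in> S x r; r \<le> t\<rbrakk> \<Longrightarrow> y \<in> S x t"
  by (fastforce simp: local_stable_def intro: order_trans)

lemma U_mono: "\<lbrakk>y \<in> U x r; r \<le> t\<rbrakk> \<Longrightarrow> y \<in> U x t"
  by (fastforce simp: local_unstable_def intro: order_trans)

lemma S_trans:
  assumes "x \<in> X" "y \<in> S x r" "z \<in> S y t" "r + t \<le> q"
  shows "z \<in> S x q"
  unfolding local_stable_def
proof (intro CollectI conjI allI)
  fix n
  have "d ((f ^^ n) x) ((f ^^ n) z) \<le> d ((f ^^ n) x) ((f ^^ n) y) + d ((f ^^ n) y) ((f ^^ n) z)"
    using assms S_in by (intro triangle fn_in) blast+
  then show "d ((f ^^ n) x) ((f ^^ n) z) \<le> q"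
    using S_dist[OF assms(2), of n] S_dist[OF assms(3), of n] assms(4) by linarith
qed (use assms S_in in blast)

lemma U_trans:
  assumes "x \<in> X" "y \<in> U x r" "z \<in> U y t" "r + t \<le> q"
  shows "z \<in> U x q"
  unfolding local_unstable_def
proof (intro CollectI conjI allI)
  fix n
  have "d ((F ^^ n) x) ((F ^^ n) z) \<le> d ((F ^^ n) x) ((F ^^ n) y) + d ((F ^^ n) y) ((F ^^ n) z)"
    using assms U_in by (intro triangle Fn_in) blast+
  then show "d ((F ^^ n) x) ((F ^^ n) z) \<le> q"
    using U_dist[OF assms(2), of n] U_dist[OF assms(3), of n] assms(4) by linarith
qed (use assms U_in in blast)

lemma S_contract:
  assumes "x \<in> X" "y \<in> S x e'"
  shows "d ((f ^^ n) x) ((f ^^ n) y) \<le> l ^ n * d x y"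
proof -
  have "x \<in> S x e'"
    using assms const_bounds by (intro S_self) auto
  then show ?thesis
    using smale assms unfolding smale_space_def by blast
qed

lemma U_contract:
  assumes "x \<in> X" "y \<in> U x e'"
  shows "d ((F ^^ n) x) ((F ^^ n) y) \<le> l ^ n * d x y"
proof -
  have "x \<in> U x e'"
    using assms const_bounds by (intro U_self) auto
  then show ?thesis
    using smale assms unfolding smale_space_def by blast
qed

lemma l_power: "0 < l ^ n" "l ^ n \<le> 1"
  using const_bounds by (auto simp: power_le_one)

text \<open>Contraction keeps all forward distances below the initial one, so at scale
  \<open>e'\<close> the size of a stable displacement can be read off at time 0.\<close>

lemma S_shrink:
  assumes "x \<in> X" "y \<in> S x e'" "d x y \<le> r"
  shows "y \<in> S x r"
  unfolding local_stable_def
proof (intro CollectI conjI allI)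
  fix n
  show "d ((f ^^ n) x) ((f ^^ n) y) \<le> r"
    using S_contract[OF assms(1,2), of n] mult_left_le_one_le[of "d x y" "l ^ n"] l_power[of n] assms(3)
    by (smt (verit) nonneg)
qed (use assms S_in in blast)

lemma U_shrink:
  assumes "x \<in> X" "y \<in> U x e'" "d x y \<le> r"
  shows "y \<in> U x r"
  unfolding local_unstable_def
proof (intro CollectI conjI allI)
  fix n
  show "d ((F ^^ n) x) ((F ^^ n) y) \<le> r"
    using U_contract[OF assms(1,2), of n] mult_left_le_one_le[of "d x y" "l ^ n"] l_power[of n] assms(3)
    by (smt (verit) nonneg)
qed (use assms U_in in blast)

section \<open>The bracket and its uniform continuity\<close>

lemma bracket_ex:
  assumes "x \<in> X" "y \<in> X" "d x y \<le> e"
  obtains z where "z \<in> S x e'" "z \<in> U y e'"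
proof -
  obtain w where "S x e' \<inter> U y e' = {w}"
    using smale assms unfolding smale_space_def by blast
  then show ?thesis
    using that by (metis IntD1 IntD2 singletonI)
qed

lemma bracket_unique:
  assumes "x \<in> X" "y \<in> X" "d x y \<le> e"
    and "z \<in> S x e'" "z \<in> U y e'" "z' \<in> S x e'" "z' \<in> U y e'"
  shows "z = z'"
proof -
  obtain w where "S x e' \<inter> U y e' = {w}"
    using smale assms(1-3) unfolding smale_space_def by blast
  then show ?thesis
    using assms(4-7) by (metis IntI singletonD)
qed

text \<open>Both points are the bracket of \<open>x\<close> with itself. This is the form in which
  expansiveness is used later.\<close>

lemma S_U_eq:
  assumes "x \<in> X" "y \<in> S x e'" "y \<in> U x e'"
  shows "y = x"
  using bracket_unique[OF assms(1,1) _ assms(2,3)] S_self U_self const_bounds assms(1) by auto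

text \<open>Each inequality defining a local stable set involves a single, continuous iterate, so it
  survives the passage to limits of both the centre and the point.\<close>

lemma S_limit:
  assumes "\<And>n. u n \<in> X" "x \<in> X" "y \<in> X" "(\<lambda>n. d (u n) x) \<longlonglongrightarrow> 0" "(\<lambda>n. d (v n) y) \<longlonglongrightarrow> 0"
    and v: "\<And>n. v n \<in> S (u n) r"
  shows "y \<in> S x r"
proof -
  have vX: "v n \<in> X" for n
    using v S_in by blast
  have "d ((f ^^ k) x) ((f ^^ k) y) \<le> r" for k
  proof (rule le_limit[OF dist_tendsto])
    show "(\<lambda>n. d ((f ^^ k) (u n)) ((f ^^ k) x)) \<longlonglongrightarrow> 0" "(\<lambda>n. d ((f ^^ k) (v n)) ((f ^^ k) y)) \<longlonglongrightarrow> 0"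
      using assms vX by (auto intro!: tendsto_f)
    show "d ((f ^^ k) (u n)) ((f ^^ k) (v n)) \<le> r" for n
      using v S_dist by blast
  qed (use assms vX in auto)
  then show ?thesis
    using assms by (simp add: local_stable_def)
qed

lemma U_limit:
  assumes "\<And>n. u n \<in> X" "x \<in> X" "y \<in> X" "(\<lambda>n. d (u n) x) \<longlonglongrightarrow> 0" "(\<lambda>n. d (v n) y) \<longlonglongrightarrow> 0"
    and v: "\<And>n. v n \<in> U (u n) r"
  shows "y \<in> U x r"
proof -
  have vX: "v n \<in> X" for n
    using v U_in by blast
  have "d ((F ^^ k) x) ((F ^^ k) y) \<le> r" for k
  proof (rule le_limit[OF dist_tendsto])
    show "(\<lambda>n. d ((F ^^ k) (u n)) ((F ^^ k) x)) \<longlonglongrightarrow> 0" "(\<lambda>n. d ((F ^^ k) (v n)) ((F ^^ k) y)) \<longlonglongrightarrow> 0"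
      using assms vX by (auto intro!: tendsto_F)
    show "d ((F ^^ k) (u n)) ((F ^^ k) (v n)) \<le> r" for n
      using v U_dist by blast
  qed (use assms vX in auto)
  then show ?thesis
    using assms by (simp add: local_unstable_def)
qed

text \<open>By compactness, counterexamples have a subsequence along which \<open>x\<close>,
  \<open>x'\<close> share a limit, \<open>y\<close>, \<open>y'\<close> share a limit, and
  \<open>z\<close>, \<open>z'\<close> converge to different points. Local stable and unstable sets
  are closed relations, so both limits are the bracket of the same pair, against uniqueness.
  Brackets occur as points satisfying the two memberships, so no bracket function has to be
  chosen.\<close>

lemma bracket_uniform:
  assumes "0 < \<epsilon>"
  obtains \<delta> where "0 < \<delta>" "\<And>x y x' y' z z'. \<lbrakk>x \<in> X; y \<in> X; x' \<in> X; y' \<in> X; d x y \<le> e; d x' y' \<le> e;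
    d x x' \<le> \<delta>; d y y' \<le> \<delta>; z \<in> S x e'; z \<in> U y e'; z' \<in> S x' e'; z' \<in> U y' e'\<rbrakk> \<Longrightarrow> d z z' \<le> \<epsilon>"
proof (rule ccontr)
  define P where "P \<equiv> \<lambda>\<delta> x y x' y' z z'. x \<in> X \<and> y \<in> X \<and> x' \<in> X \<and> y' \<in> X \<and> d x y \<le> e \<and> d x' y' \<le> e \<and>
    d x x' \<le> \<delta> \<and> d y y' \<le> \<delta> \<and> z \<in> S x e' \<and> z \<in> U y e' \<and> z' \<in> S x' e' \<and> z' \<in> U y' e' \<and> \<not> d z z' \<le> \<epsilon>"
  assume n: "\<not> thesis"
  note * = that
  have "\<exists>x y x' y' z z'. P \<delta> x y x' y' z z'" if "0 < \<delta>" for \<delta>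
    using n *[of \<delta>] \<open>0 < \<delta>\<close> unfolding P_def by metis
  then have "\<forall>k. \<exists>x y x' y' z z'. P (inverse (real (Suc k))) x y x' y' z z'"
    by simp
  then obtain x y x' y' z z' where P: "\<And>k. P (inverse (real (Suc k))) (x k) (y k) (x' k) (y' k) (z k) (z' k)"
    by metis
  then have X: "x k \<in> X" "y k \<in> X" "x' k \<in> X" "y' k \<in> X" "z k \<in> X" "z' k \<in> X" for k
    unfolding P_def using S_in by blast+
  obtain x0 y0 r where r: "x0 \<in> X" "y0 \<in> X" "strict_mono (r :: nat \<Rightarrow> nat)"
    "(\<lambda>n. d (x (r n)) x0) \<longlonglongrightarrow> 0" "(\<lambda>n. d (y (r n)) y0) \<longlonglongrightarrow> 0"
    by (rule compact_subseq2[OF compact X(1,2)])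
  obtain z0 z1 s where s: "z0 \<in> X" "z1 \<in> X" "strict_mono (s :: nat \<Rightarrow> nat)"
    "(\<lambda>n. d (z (r (s n))) z0) \<longlonglongrightarrow> 0" "(\<lambda>n. d (z' (r (s n))) z1) \<longlonglongrightarrow> 0"
    by (rule compact_subseq2[OF compact, of "\<lambda>n. z (r n)" "\<lambda>n. z' (r n)"]) (use X in auto)
  define t where "t \<equiv> \<lambda>n. r (s n)"
  have t: "strict_mono t"
    using r s by (simp add: t_def strict_mono_def)
  have x0: "(\<lambda>n. d (x (t n)) x0) \<longlonglongrightarrow> 0" and y0: "(\<lambda>n. d (y (t n)) y0) \<longlonglongrightarrow> 0"
    using LIMSEQ_subseq_LIMSEQ[OF r(4) s(3)] LIMSEQ_subseq_LIMSEQ[OF r(5) s(3)] by (simp_all add: o_def t_def)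
  have xx': "(\<lambda>n. d (x n) (x' n)) \<longlonglongrightarrow> 0" "(\<lambda>n. d (y n) (y' n)) \<longlonglongrightarrow> 0"
    using P unfolding P_def by (auto intro!: tendsto_0_le_inverse_Suc)
  \<comment> \<open>Sequences whose mutual distance tends to 0 have the same subsequential limit;
    this gives \<open>x'\<close> and \<open>y'\<close> the limits of \<open>x\<close> and
    \<open>y\<close>.\<close>
  have close: "(\<lambda>n. d (u' (t n)) w) \<longlonglongrightarrow> 0" if "\<And>n. u n \<in> X" "\<And>n. u' n \<in> X" "w \<in> X"
    "(\<lambda>n. d (u (t n)) w) \<longlonglongrightarrow> 0" "(\<lambda>n. d (u n) (u' n)) \<longlonglongrightarrow> 0" for u u' w
  proof (rule Lim_null_comparison)
    show "(\<lambda>n. d (u (t n)) (u' (t n)) + d (u (t n)) w) \<longlonglongrightarrow> 0"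
      using tendsto_add[OF LIMSEQ_subseq_LIMSEQ[OF that(5) t] that(4)] by (simp add: o_def)
    have "d (u' (t n)) w \<le> d (u (t n)) (u' (t n)) + d (u (t n)) w" for n
      using triangle[of "u' (t n)" "u (t n)" w] that commute by simp
    then show "\<forall>\<^sub>F n in sequentially. norm (d (u' (t n)) w) \<le> d (u (t n)) (u' (t n)) + d (u (t n)) w"
      by simp
  qed
  note x1 = close[OF X(1,3) r(1) x0 xx'(1)] and y1 = close[OF X(2,4) r(2) y0 xx'(2)]
  have zl: "(\<lambda>n. d (z (t n)) z0) \<longlonglongrightarrow> 0" "(\<lambda>n. d (z' (t n)) z1) \<longlonglongrightarrow> 0"
    using s(4,5) by (simp_all add: t_def)
  have PP: "z (t k) \<in> S (x (t k)) e'" "z (t k) \<in> U (y (t k)) e'" "z' (t k) \<in> S (x' (t k)) e'"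
    "z' (t k) \<in> U (y' (t k)) e'" "d (x (t k)) (y (t k)) \<le> e" for k
    using P[of "t k"] unfolding P_def by blast+
  note Xt = X[of "t _"]
  have "z0 \<in> S x0 e'"
    by (rule S_limit[OF Xt(1) r(1) s(1) x0 zl(1) PP(1)])
  moreover have "z0 \<in> U y0 e'"
    by (rule U_limit[OF Xt(2) r(2) s(1) y0 zl(1) PP(2)])
  moreover have "z1 \<in> S x0 e'"
    by (rule S_limit[OF Xt(3) r(1) s(2) x1 zl(2) PP(3)])
  moreover have "z1 \<in> U y0 e'"
    by (rule U_limit[OF Xt(4) r(2) s(2) y1 zl(2) PP(4)])
  moreover have "d x0 y0 \<le> e"
    by (rule le_limit[OF dist_tendsto[OF Xt(1) Xt(2) r(1,2) x0 y0] PP(5)])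
  ultimately have "z0 = z1"
    using r bracket_unique[of x0 y0 z0 z1] by metis
  have "(\<lambda>n. d (z (t n)) (z' (t n))) \<longlonglongrightarrow> d z0 z1"
    using s X unfolding t_def by (intro dist_tendsto) auto
  then have "\<forall>\<^sub>F n in sequentially. d (z (t n)) (z' (t n)) < \<epsilon>"
    using \<open>z0 = z1\<close> assms s by (intro order_tendstoD) auto
  then show False
    using P unfolding P_def eventually_sequentially by (meson order_refl less_imp_le)
qed

text \<open>The bracket of \<open>y\<close> with itself is \<open>y\<close>, so uniform continuity
  puts the bracket of two close points near both of them; \<open>S_shrink\<close> and
  \<open>U_shrink\<close> turn this distance at time 0 into the size of the local sets.\<close>

lemma bracket_small:
  assumes "0 < \<epsilon>"
  obtains \<delta> where "0 < \<delta>" "\<delta> \<le> e" "\<And>x y. \<lbrakk>x \<in> X; y \<in> X; d x y \<le> \<delta>\<rbrakk> \<Longrightarrow> \<exists>z. z \<in> S x \<epsilon> \<and> z \<in> U y \<epsilon>"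
    "\<And>x y z. \<lbrakk>x \<in> X; y \<in> X; d x y \<le> \<delta>; z \<in> S x e'; z \<in> U y e'\<rbrakk> \<Longrightarrow> z \<in> S x \<epsilon> \<and> z \<in> U y \<epsilon>"
proof -
  obtain \<delta> where \<delta>: "0 < \<delta>" "\<And>x y x' y' z z'. \<lbrakk>x \<in> X; y \<in> X; x' \<in> X; y' \<in> X; d x y \<le> e; d x' y' \<le> e;
    d x x' \<le> \<delta>; d y y' \<le> \<delta>; z \<in> S x e'; z \<in> U y e'; z' \<in> S x' e'; z' \<in> U y' e'\<rbrakk> \<Longrightarrow> d z z' \<le> \<epsilon> / 2"
    using bracket_uniform[of "\<epsilon> / 2"] assms by (metis half_gt_zero)
  define \<delta>' where "\<delta>' = min (min \<delta> e) (\<epsilon> / 2)"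
  have *: "z \<in> S x \<epsilon> \<and> z \<in> U y \<epsilon>" if xy: "x \<in> X" "y \<in> X" "d x y \<le> \<delta>'" "z \<in> S x e'" "z \<in> U y e'" for x y z
  proof -
    have "z \<in> X"
      using xy S_in by blast
    have zy: "d z y \<le> \<epsilon> / 2"
      using xy \<delta>(1) const_bounds S_self[of y e'] U_self[of y e'] by (intro \<delta>(2)[of x y y y]) (auto simp: \<delta>'_def)
    moreover have "d z x \<le> d z y + d x y"
      using xy \<open>z \<in> X\<close> by (metis triangle commute)
    ultimately have "d x z \<le> \<epsilon>" "d y z \<le> \<epsilon>"
      using xy assms by (auto simp: \<delta>'_def commute)
    then show ?thesis
      using S_shrink U_shrink xy by blast
  qed
  show ?thesis
  proof (rule that[of \<delta>'])
    show "0 < \<delta>'" "\<delta>' \<le> e"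
      using \<delta> const_bounds assms by (auto simp: \<delta>'_def)
    show "\<exists>z. z \<in> S x \<epsilon> \<and> z \<in> U y \<epsilon>" if xy: "x \<in> X" "y \<in> X" "d x y \<le> \<delta>'" for x y
    proof -
      have "d x y \<le> e"
        using xy by (simp add: \<delta>'_def)
      then obtain z where "z \<in> S x e'" "z \<in> U y e'"
        using bracket_ex xy by blast
      then show ?thesis
        using * xy by blast
    qed
  qed (rule *)
qed

section \<open>Bump functions constant along local stable sets\<close>

lemma compact_S:
  assumes "a \<in> X"
  shows "compactin mtopology (S a r)"
  unfolding compactin_sequentially
proof (intro conjI allI impI)
  show "S a r \<subseteq> X"
    using S_in by blast
  fix \<sigma> :: "nat \<Rightarrow> 'a"
  assume \<sigma>: "range \<sigma> \<subseteq> S a r"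
  then have S: "\<sigma> n \<in> S a r" for n
    by blast
  obtain x t where x: "x \<in> X" "strict_mono (t :: nat \<Rightarrow> nat)" "(\<lambda>n. d (\<sigma> (t n)) x) \<longlonglongrightarrow> 0"
    by (rule compact_subseq[OF compact S_in[OF S]])
  have "x \<in> S a r"
    using assms x S by (intro S_limit[of "\<lambda>_. a" a x "\<lambda>n. \<sigma> (t n)"]) auto
  moreover have "limitin mtopology (\<sigma> \<circ> t) x sequentially"
    using x S S_in by (auto simp: limitin_metric_dist_null intro!: always_eventually)
  ultimately show "\<exists>x t. x \<in> S a r \<and> strict_mono t \<and> limitin mtopology (\<sigma> \<circ> t) x sequentially"
    using x by blast
qed

lemma compact_separation:
  assumes "compactin mtopology C" "compactin mtopology D" "C \<inter> D = {}"
  obtains \<kappa> where "0 < \<kappa>" "\<And>x y. \<lbrakk>x \<in> C; y \<in> D\<rbrakk> \<Longrightarrow> \<kappa> \<le> d x y"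
proof -
  have sub: "C \<subseteq> X" "D \<subseteq> X"
    using assms compactin_subset_topspace by force+
  have "\<exists>\<kappa>>0. \<forall>x\<in>C. \<forall>y\<in>D. \<kappa> \<le> d x y"
  proof (rule ccontr)
    assume n: "\<not> ?thesis"
    have "\<forall>k. \<exists>x y. x \<in> C \<and> y \<in> D \<and> d x y \<le> inverse (real (Suc k))"
    proof
      fix k
      have "0 < inverse (real (Suc k))"
        by simp
      then have "\<not> (\<forall>x\<in>C. \<forall>y\<in>D. inverse (real (Suc k)) \<le> d x y)"
        using n by blast
      then show "\<exists>x y. x \<in> C \<and> y \<in> D \<and> d x y \<le> inverse (real (Suc k))"
        by (meson linear)
    qed
    then obtain u v where uv: "\<And>k. u k \<in> C" "\<And>k. v k \<in> D" "\<And>k. d (u k) (v k) \<le> inverse (real (Suc k))"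
      by metis
    then have uX: "u k \<in> X" "v k \<in> X" for k
      using sub by blast+
    obtain x y r where r: "x \<in> X" "y \<in> X" "strict_mono (r :: nat \<Rightarrow> nat)"
      "(\<lambda>n. d (u (r n)) x) \<longlonglongrightarrow> 0" "(\<lambda>n. d (v (r n)) y) \<longlonglongrightarrow> 0"
      by (rule compact_subseq2[OF compact uX])
    have "(\<lambda>n. d (u n) (v n)) \<longlonglongrightarrow> 0"
      using uv(3) by (intro tendsto_0_le_inverse_Suc) auto
    from LIMSEQ_subseq_LIMSEQ[OF this r(3)] have "(\<lambda>n. d (u (r n)) (v (r n))) \<longlonglongrightarrow> 0"
      by (simp add: o_def)
    moreover have "(\<lambda>n. d (u (r n)) (v (r n))) \<longlonglongrightarrow> d x y"
      using r uX by (intro dist_tendsto) auto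
    ultimately have "x = y"
      using LIMSEQ_unique r by fastforce
    have closed: "closedin mtopology C" "closedin mtopology D"
      using assms compactin_imp_closedin Hausdorff_space_mtopology by blast+
    have "x \<in> C"
      by (rule limitin_closedin[OF _ closed(1), of "\<lambda>n. u (r n)" _ sequentially])
        (use r uX uv in \<open>auto simp: limitin_metric_dist_null\<close>)
    moreover have "y \<in> D"
      by (rule limitin_closedin[OF _ closed(2), of "\<lambda>n. v (r n)" _ sequentially])
        (use r uX uv in \<open>auto simp: limitin_metric_dist_null\<close>)
    ultimately show False
      using \<open>x = y\<close> assms by blast
  qed
  then show ?thesis
    using that by blast
qed

text \<open>\<open>S a r\<close> is compact Hausdorff and its connected subsets have at most one
  point, so a relatively clopen set \<open>C\<close> separates \<open>a\<close> from everything
  outside a small ball. \<open>C\<close> and its complement in \<open>S a r\<close> are disjoint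
  compact sets, and \<open>\<kappa>\<close> is a positive gap between them. The bound
  \<open>r \<le> e\<close> is the range in which total disconnectedness is given.\<close>

lemma stable_clopen:
  assumes td: "totally_disconnected_local_stable X d f e"
    and "a \<in> X" "0 < r" "r \<le> e" "0 < \<rho>"
  obtains C \<kappa> where "a \<in> C" "\<And>x. x \<in> C \<Longrightarrow> x \<in> S a r \<and> d x a \<le> \<rho>" "0 < \<kappa>"
    "\<And>x y. \<lbrakk>x \<in> S a r; y \<in> S a r; d x y < \<kappa>\<rbrakk> \<Longrightarrow> x \<in> C \<longleftrightarrow> y \<in> C"
proof -
  let ?T = "subtopology mtopology (S a r)"
  let ?B = "S a r - mball a \<rho>"
  have SX: "S a r \<subseteq> X"
    using S_in by blast
  have comp: "compactin mtopology (S a r)"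
    using assms compact_S by blast
  have top: "topspace ?T = S a r"
    using SX by auto
  have aS: "a \<in> S a r"
    using assms by (intro S_self) auto
  have "separated_between ?T {a} ?B"
  proof (rule cut_wire_fence_theorem_gen)
    show "compact_space ?T"
      using comp compact_space_subtopology by blast
    show "Hausdorff_space ?T \<or> regular_space ?T \<or> normal_space ?T"
      by (simp add: Hausdorff_space_mtopology Hausdorff_space_subtopology)
    show "compactin ?T {a}"
      using aS SX by auto
    have "closedin ?T (topspace ?T - S a r \<inter> mball a \<rho>)"
      by (intro closedin_diff closedin_topspace openin_subtopology_Int2 openin_mball)
    then show "closedin ?T ?B"
      unfolding top by (simp add: Diff_Int_distrib Diff_Int2 Diff_Int)
    show "disjnt C {a} \<or> disjnt C ?B" if C: "connectedin ?T C" for C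
    proof -
      have "\<exists>b. C \<subseteq> {b}"
        using td assms C unfolding totally_disconnected_local_stable_def totally_disconnectedin_def
          connectedin_subtopology by blast
      moreover have "a \<notin> ?B"
        using assms by simp
      ultimately show ?thesis
        unfolding disjnt_iff by blast
    qed
  qed
  then obtain C where C: "closedin ?T C" "openin ?T C" "a \<in> C" "?B \<subseteq> topspace ?T - C"
    unfolding separated_between by blast
  have CS: "C \<subseteq> S a r"
    using C(1) top closedin_subset by blast
  have "closedin ?T (topspace ?T - C)"
    using C by (intro closedin_diff closedin_topspace)
  then have "compactin mtopology (S a r - C)"
    unfolding top using comp closed_compactin[OF comp, of "S a r - C"]
    by (metis Diff_subset closedin_closed_subtopology comp compactin_imp_closedin Hausdorff_space_mtopology)
  moreover have "compactin mtopology C"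
    using C(1) CS comp closed_compactin[OF comp, of C]
    by (metis closedin_closed_subtopology compactin_imp_closedin Hausdorff_space_mtopology)
  ultimately have cc: "compactin mtopology C" "compactin mtopology (S a r - C)"
    by blast+
  obtain \<kappa> where \<kappa>: "0 < \<kappa>" "\<And>x y. \<lbrakk>x \<in> C; y \<in> S a r - C\<rbrakk> \<Longrightarrow> \<kappa> \<le> d x y"
    by (rule compact_separation[OF cc]) auto
  show ?thesis
  proof (rule that[of C \<kappa>])
    show "x \<in> S a r \<and> d x a \<le> \<rho>" if "x \<in> C" for x
    proof -
      have "x \<in> mball a \<rho>"
        using C(4) CS top that by blast
      then show ?thesis
        using CS that by (auto simp: commute)
    qed
    show "x \<in> C \<longleftrightarrow> y \<in> C" if "x \<in> S a r" "y \<in> S a r" "d x y < \<kappa>" for x y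
      using \<kappa>(2)[of x y] \<kappa>(2)[of y x] that commute[of x y] by fastforce
  qed (use C \<kappa> in auto)
qed

text \<open>The backward orbit of \<open>(f ^^ n) y\<close> first runs through the forward iterates
  of \<open>y\<close> up to time \<open>n\<close> and then through the backward orbit of
  \<open>y\<close>; the two closeness hypotheses control these two stretches.\<close>

lemma unstable_image:
  assumes "y \<in> X" "z \<in> X" "\<And>j. j \<le> n \<Longrightarrow> d ((f ^^ j) y) ((f ^^ j) z) \<le> r" "z \<in> U y r"
  shows "(f ^^ n) z \<in> U ((f ^^ n) y) r"
  unfolding local_unstable_def
proof (intro CollectI conjI allI)
  fix i
  show "d ((F ^^ i) ((f ^^ n) y)) ((F ^^ i) ((f ^^ n) z)) \<le> r"
    using assms U_dist[OF assms(4)] by (cases "i \<le> n") (auto simp: Fm_fn)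
qed (use assms in auto)

lemma unstable_preimage:
  assumes "y \<in> X" "z \<in> X" "(f ^^ n) z \<in> U ((f ^^ n) y) r"
  shows "j \<le> n \<Longrightarrow> d ((f ^^ j) y) ((f ^^ j) z) \<le> r" and "m \<le> n \<Longrightarrow> (f ^^ m) z \<in> U ((f ^^ m) y) r"
proof -
  have d: "d ((F ^^ i) ((f ^^ n) y)) ((F ^^ i) ((f ^^ n) z)) \<le> r" for i
    using U_dist assms by blast
  show "d ((f ^^ j) y) ((f ^^ j) z) \<le> r" if "j \<le> n" for j
    using d[of "n - j"] assms that by (simp add: Fm_fn)
  show "(f ^^ m) z \<in> U ((f ^^ m) y) r" if m: "m \<le> n"
    unfolding local_unstable_def
  proof (intro CollectI conjI allI)
    fix i
    show "d ((F ^^ i) ((f ^^ m) y)) ((F ^^ i) ((f ^^ m) z)) \<le> r"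
    proof -
      have "(F ^^ (i + (n - m))) ((f ^^ n) x) = (F ^^ i) ((f ^^ m) x)" if "x \<in> X" for x
        using that m by (simp only: funpow_add o_apply) (simp add: Fm_fn)
      then show ?thesis
        using d[of "i + (n - m)"] assms by simp
    qed
  qed (use assms in auto)
qed

text \<open>\<open>\<eta>\<close> is the size of stable displacement that \<open>\<phi>\<close> does
  not see. The last clause replaces a Lipschitz bound along unstable sets: its hypothesis says that
  \<open>y\<close> and \<open>z\<close> lie on a common unstable set and stay
  \<open>\<eta>\<close>-close up to time \<open>n\<close>.\<close>

definition bump :: "'a \<Rightarrow> real \<Rightarrow> ('a \<Rightarrow> real) \<Rightarrow> real \<Rightarrow> real \<Rightarrow> bool" where
  "bump a \<epsilon> \<phi> \<eta> R \<longleftrightarrow> 0 < \<eta> \<and> 0 \<le> R \<and> (\<forall>x. 0 \<le> \<phi> x) \<and> (\<forall>x. \<phi> x \<le> 1) \<and> \<phi> a = 1 \<and>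
    (\<forall>x. 0 < \<phi> x \<longrightarrow> d x a \<le> \<epsilon>) \<and>
    (\<forall>\<epsilon>>0. \<exists>\<delta>>0. \<forall>x\<in>X. \<forall>y\<in>X. d x y \<le> \<delta> \<longrightarrow> \<bar>\<phi> x - \<phi> y\<bar> \<le> \<epsilon>) \<and>
    (\<forall>x y. x \<in> X \<longrightarrow> y \<in> S x \<eta> \<longrightarrow> \<phi> x = \<phi> y) \<and>
    (\<forall>y z n. y \<in> X \<longrightarrow> z \<in> X \<longrightarrow> (f ^^ n) z \<in> U ((f ^^ n) y) \<eta> \<longrightarrow> \<bar>\<phi> y - \<phi> z\<bar> \<le> R * l ^ n)"

text \<open>A small stable displacement of \<open>x\<close> does not change its bracket with
  \<open>a\<close>, so a function of this bracket is constant along stable sets. The clopen piece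
  \<open>C\<close> cuts it off in the stable direction without a jump. Along unstable sets the
  brackets stay close for as long as the points do, and backward contraction yields the factor
  \<open>l ^ n\<close>.\<close>

lemma local_bump:
  assumes td: "totally_disconnected_local_stable X d f e" and a: "a \<in> X" and "0 < \<epsilon>0"
  shows "\<exists>\<phi> \<eta> R. bump a \<epsilon>0 \<phi> \<eta> R"
proof -
  \<comment> \<open>The factor 4 leaves room for up to three displacements of size at most
    \<open>h\<close> to be combined within \<open>e'\<close>; \<open>h \<le> e\<close> makes total
    disconnectedness available for \<open>S a h\<close>.\<close>
  define h where "h = min (e' / 4) e"
  have h: "0 < h" "h \<le> e" "4 * h \<le> e'"
    using const_bounds by (auto simp: h_def min_def)
  obtain s where s: "0 < s" "s \<le> e" "\<And>x y. \<lbrakk>x \<in> X; y \<in> X; d x y \<le> s\<rbrakk> \<Longrightarrow> \<exists>z. z \<in> S x h \<and> z \<in> U y h"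
    by (rule bracket_small[OF h(1)]) blast
  define p where "p x = (SOME z. z \<in> S x h \<and> z \<in> U a h)" for x
  define q where "q x = (SOME z. z \<in> S a h \<and> z \<in> U x h)" for x
  have p: "p x \<in> S x h" "p x \<in> U a h" "p x \<in> X" if "x \<in> X" "d x a \<le> s" for x
    using someI_ex[OF s(3)[OF that(1) a that(2)]] S_in unfolding p_def by blast+
  have q: "q x \<in> S a h" "q x \<in> U x h" "q x \<in> X" if "x \<in> X" "d x a \<le> s" for x
    using someI_ex[OF s(3)[OF a that(1)]] that commute[of x a] S_in unfolding q_def by auto
  have p': "p x \<in> S x e'" "p x \<in> U a e'" and q': "q x \<in> S a e'" "q x \<in> U x e'"
    if "x \<in> X" "d x a \<le> s" for x
    using p[OF that] q[OF that] h const_bounds by (auto intro: S_mono U_mono)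
  \<comment> \<open>\<open>m\<close> bounds the radius of the support. It is at most
    \<open>s / 2\<close>, as is \<open>\<eta>\<close> below, so points within \<open>\<eta>\<close>
    of the support still have brackets with \<open>a\<close>.\<close>
  define m where "m = min \<epsilon>0 s / 2"
  have m: "0 < m" "m \<le> \<epsilon>0" "m \<le> s / 2"
    using s assms by (auto simp: m_def)
  obtain \<delta>3 where \<delta>3: "0 < \<delta>3" "\<And>x y z. \<lbrakk>x \<in> X; y \<in> X; d x y \<le> \<delta>3; z \<in> S x e'; z \<in> U y e'\<rbrakk> \<Longrightarrow> z \<in> S x (m/2) \<and> z \<in> U y (m/2)"
    by (rule bracket_small[of "m/2"]) (use m in auto)
  define \<rho> where "\<rho> = min (\<delta>3 / 2) (m / 2)"
  have \<rho>: "0 < \<rho>" "2 * \<rho> \<le> \<delta>3" "\<rho> \<le> m / 2"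
    using \<delta>3 m by (auto simp: \<rho>_def)
  obtain C \<kappa> where C: "a \<in> C" "\<And>x. x \<in> C \<Longrightarrow> x \<in> S a h \<and> d x a \<le> \<rho>" "0 < \<kappa>"
    "\<And>x y. \<lbrakk>x \<in> S a h; y \<in> S a h; d x y < \<kappa>\<rbrakk> \<Longrightarrow> x \<in> C \<longleftrightarrow> y \<in> C"
    by (rule stable_clopen[OF td a h(1,2) \<rho>(1)]) blast
  obtain \<delta>4 where \<delta>4: "0 < \<delta>4" "\<And>x y x' y' z z'. \<lbrakk>x \<in> X; y \<in> X; x' \<in> X; y' \<in> X; d x y \<le> e; d x' y' \<le> e;
    d x x' \<le> \<delta>4; d y y' \<le> \<delta>4; z \<in> S x e'; z \<in> U y e'; z' \<in> S x' e'; z' \<in> U y' e'\<rbrakk> \<Longrightarrow> d z z' \<le> \<kappa>/2"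
    by (rule bracket_uniform[of "\<kappa>/2"]) (use C in auto)
  define \<eta> where "\<eta> = min (min \<delta>4 (s/2)) h"
  have \<eta>: "0 < \<eta>" "\<eta> \<le> \<delta>4" "\<eta> \<le> s / 2" "\<eta> \<le> h"
    using \<delta>4 s h by (auto simp: \<eta>_def)
  \<comment> \<open>\<open>p x\<close> and \<open>q x\<close> are the brackets \<open>[x, a]\<close> and \<open>[a, x]\<close>, the unstable and stable coordinates of \<open>x\<close>.\<close>
  define \<phi> where "\<phi> x = (if x \<in> X \<and> d x a \<le> s \<and> q x \<in> C then max 0 (1 - d (p x) a / \<rho>) else 0)" for x
  have nn: "0 \<le> \<phi> x" and le1: "\<phi> x \<le> 1" for x
    using \<rho> by (auto simp: \<phi>_def)
  have supp: "d x a \<le> m" if "0 < \<phi> x" for x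
  proof -
    have x: "x \<in> X" "d x a \<le> s" "q x \<in> C"
      using that by (auto simp: \<phi>_def split: if_splits)
    then have "0 < 1 - d (p x) a / \<rho>"
      using that by (auto simp: \<phi>_def)
    then have px: "d (p x) a < \<rho>"
      using \<rho> by (simp add: field_simps)
    have "d (p x) (q x) \<le> d (p x) a + d (q x) a"
      using triangle[of "p x" a "q x"] p[OF x(1,2)] q[OF x(1,2)] a commute by simp
    then have "d (p x) (q x) \<le> \<delta>3"
      using px C(2)[OF x(3)] \<rho> by simp
    \<comment> \<open>The point \<open>x\<close> is itself the bracket of its coordinates
      \<open>p x\<close> and \<open>q x\<close>. Since both lie within \<open>\<rho>\<close> of
      \<open>a\<close>, they are within \<open>\<delta>3\<close> of each other, and their bracket is
      close to them.\<close>
    then have "x \<in> S (p x) (m/2)"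
      using \<delta>3(2)[of "p x" "q x" x] p[OF x(1,2)] q[OF x(1,2)] p'[OF x(1,2)] q'[OF x(1,2)] x S_sym U_sym by blast
    then have "d (p x) x \<le> m/2"
      by (rule S_dist0)
    moreover have "d x a \<le> d (p x) x + d (p x) a"
      using triangle[of x "p x" a] p[OF x(1,2)] a x commute by simp
    ultimately show ?thesis
      using px \<rho> by simp
  qed
  \<comment> \<open>A move by \<open>\<eta>\<close> displaces \<open>q\<close> by at most
    \<open>\<kappa> / 2\<close>, too little to cross the gap between \<open>C\<close> and its
    complement. So the cut-off has the same value at both points, and only \<open>p\<close>
    contributes to the difference.\<close>
  have key: "\<phi> x = 0 \<and> \<phi> y = 0 \<or> d x a \<le> s \<and> d y a \<le> s \<and> \<bar>\<phi> x - \<phi> y\<bar> \<le> d (p x) (p y) / \<rho>"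
    if x: "x \<in> X" and y: "y \<in> X" and xy: "d x y \<le> \<eta>" for x y
  proof (cases "d x a \<le> s \<and> d y a \<le> s")
    case True
    have "d (q x) (q y) \<le> \<kappa> / 2"
      using \<delta>4(2)[OF a x a y _ _ _ _ q'(1) q'(2) q'(1) q'(2)] True x y xy \<eta> a s \<delta>4(1) by (simp add: commute)
    then have qC: "q x \<in> C \<longleftrightarrow> q y \<in> C"
      using C(3) q x y True by (intro C(4)) auto
    show ?thesis
    proof (cases "q x \<in> C")
      case True': True
      have P: "p x \<in> X" "p y \<in> X"
        using p x y True by blast+
      have "\<bar>d (p x) a - d (p y) a\<bar> \<le> d (p x) (p y)"
        using mdist_reverse_triangle[of "p x" a "p y"] P a commute by (simp add: abs_diff_le_iff)
      then have "\<bar>d (p x) a / \<rho> - d (p y) a / \<rho>\<bar> \<le> d (p x) (p y) / \<rho>"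
        using \<rho>(1) by (simp add: abs_le_iff field_simps)
      then show ?thesis
        using True True' qC x y unfolding \<phi>_def by auto
    qed (use qC in \<open>auto simp: \<phi>_def\<close>)
  next
    case False
    have "d x a \<le> d x y + d y a" "d y a \<le> d x y + d x a"
      using triangle[of x y a] triangle[of y x a] x y a commute[of x y] by auto
    then have "\<not> 0 < \<phi> x" "\<not> 0 < \<phi> y"
      using False supp[of x] supp[of y] xy \<eta> m by auto
    then show ?thesis
      using nn[of x] nn[of y] by linarith
  qed
  have "bump a \<epsilon>0 \<phi> \<eta> (e' / \<rho>)"
    unfolding bump_def
  proof (intro conjI allI impI)
    show "0 < \<eta>" "0 \<le> e' / \<rho>" "0 \<le> \<phi> x" "\<phi> x \<le> 1" for x
      using \<eta> \<rho> const_bounds nn le1 by auto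
    have a0: "d a a \<le> s"
      using a s by simp
    have ae': "a \<in> S a e'" "a \<in> U a e'"
      using a const_bounds by (auto intro: S_self U_self)
    have "p a = a" "q a = a"
      using bracket_unique[OF a a _ p'[OF a a0] ae'] bracket_unique[OF a a _ q'[OF a a0] ae'] a const_bounds by auto
    then show "\<phi> a = 1"
      using C a s by (simp add: \<phi>_def)
    show "d x a \<le> \<epsilon>0" if "0 < \<phi> x" for x
      using supp[OF that] m by simp
    show "\<exists>\<delta>>0. \<forall>x\<in>X. \<forall>y\<in>X. d x y \<le> \<delta> \<longrightarrow> \<bar>\<phi> x - \<phi> y\<bar> \<le> \<epsilon>" if \<epsilon>: "0 < \<epsilon>" for \<epsilon>
    proof -
      obtain \<delta>5 where \<delta>5: "0 < \<delta>5" "\<And>x y x' y' z z'. \<lbrakk>x \<in> X; y \<in> X; x' \<in> X; y' \<in> X; d x y \<le> e; d x' y' \<le> e;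
        d x x' \<le> \<delta>5; d y y' \<le> \<delta>5; z \<in> S x e'; z \<in> U y e'; z' \<in> S x' e'; z' \<in> U y' e'\<rbrakk> \<Longrightarrow> d z z' \<le> \<epsilon> * \<rho>"
        by (rule bracket_uniform[of "\<epsilon> * \<rho>"]) (use \<epsilon> \<rho> in auto)
      have "\<bar>\<phi> x - \<phi> y\<bar> \<le> \<epsilon>" if xy: "x \<in> X" "y \<in> X" "d x y \<le> min \<eta> \<delta>5" for x y
      proof (cases "\<phi> x = 0 \<and> \<phi> y = 0")
        case False
        then have k: "d x a \<le> s" "d y a \<le> s" "\<bar>\<phi> x - \<phi> y\<bar> \<le> d (p x) (p y) / \<rho>"
          using key[of x y] xy by auto
        have "d (p x) (p y) \<le> \<epsilon> * \<rho>"
          using \<delta>5(2)[OF xy(1) a xy(2) a _ _ _ _ p'[OF xy(1) k(1)] p'[OF xy(2) k(2)]] xy k s a \<delta>5(1) by simp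
        then have "d (p x) (p y) / \<rho> \<le> \<epsilon>"
          using \<rho> by (simp add: field_simps)
        then show ?thesis
          using k by simp
      qed (use \<open>0 < \<epsilon>\<close> in simp)
      then show ?thesis
        using \<eta> \<delta>5 by (intro exI[of _ "min \<eta> \<delta>5"]) auto
    qed
    show "\<phi> x = \<phi> y" if x: "x \<in> X" and yS: "y \<in> S x \<eta>" for x y
    proof (cases "\<phi> x = 0 \<and> \<phi> y = 0")
      case False
      have y: "y \<in> X"
        using yS S_in by blast
      have k: "d x a \<le> s" "d y a \<le> s" "\<bar>\<phi> x - \<phi> y\<bar> \<le> d (p x) (p y) / \<rho>"
        using key[OF x y S_dist0[OF yS]] False by auto
      \<comment> \<open>As \<open>y\<close> lies on the stable set of \<open>x\<close>, the bracket
        of \<open>y\<close> with \<open>a\<close> is also a bracket of \<open>x\<close> with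
        \<open>a\<close>.\<close>
      have "p y \<in> S x e'"
        using S_trans[OF x yS p(1)[OF y k(2)]] \<eta> h by simp
      then have "p x = p y"
        using bracket_unique[OF x a _ p'[OF x k(1)] _ p'(2)[OF y k(2)]] k s by simp
      then show ?thesis
        using k p[OF x k(1)] by simp
    qed simp
    show "\<bar>\<phi> y - \<phi> z\<bar> \<le> e' / \<rho> * l ^ n" if y: "y \<in> X" and z: "z \<in> X" and n: "(f ^^ n) z \<in> U ((f ^^ n) y) \<eta>" for y z n
    proof (cases "\<phi> y = 0 \<and> \<phi> z = 0")
      case False
      have fj: "d ((f ^^ j) y) ((f ^^ j) z) \<le> \<eta>" if "j \<le> n" for j
        using unstable_preimage(1)[OF y z n that] .
      have k: "d y a \<le> s" "d z a \<le> s" "\<bar>\<phi> y - \<phi> z\<bar> \<le> d (p y) (p z) / \<rho>"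
        using key[OF y z] fj[of 0] False by auto
      note py = p[OF y k(1)] and pz = p[OF z k(2)]
      \<comment> \<open>\<open>p y\<close> follows \<open>y\<close> and \<open>p z\<close> follows
        \<open>z\<close> forward in time, while both lie on the unstable set of \<open>a\<close>;
        hence closeness of \<open>y\<close> and \<open>z\<close> up to time \<open>n\<close> passes
        to \<open>p y\<close> and \<open>p z\<close>.\<close>
      have image: "(f ^^ n) (p z) \<in> U ((f ^^ n) (p y)) e'"
      proof (rule unstable_image[OF py(3) pz(3)])
        fix j assume j: "j \<le> n"
        have "d ((f ^^ j) (p y)) ((f ^^ j) (p z)) \<le> d ((f ^^ j) (p y)) ((f ^^ j) y) + d ((f ^^ j) y) ((f ^^ j) (p z))"
          using py pz y by (intro triangle) auto
        also have "d ((f ^^ j) y) ((f ^^ j) (p z)) \<le> d ((f ^^ j) y) ((f ^^ j) z) + d ((f ^^ j) z) ((f ^^ j) (p z))"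
          using py pz y z by (intro triangle) auto
        finally show "d ((f ^^ j) (p y)) ((f ^^ j) (p z)) \<le> e'"
          using fj[OF j] S_dist[OF py(1), of j] S_dist[OF pz(1), of j] \<eta> h commute[of "(f ^^ j) y"] by simp
      next
        show "p z \<in> U (p y) e'"
          by (rule U_trans[OF py(3) U_sym[OF a py(2)] pz(2)]) (use h const_bounds in simp)
      qed
      have "d (p y) (p z) \<le> l ^ n * d ((f ^^ n) (p y)) ((f ^^ n) (p z))"
        using U_contract[OF fn_in[OF py(3)] image, of n] py pz by simp
      also have "\<dots> \<le> l ^ n * e'"
        using U_dist0[OF image] l_power[of n] by (intro mult_left_mono) auto
      finally have "d (p y) (p z) \<le> l ^ n * e'" .
      then have "d (p y) (p z) / \<rho> \<le> e' / \<rho> * l ^ n"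
        using \<rho> by (simp add: field_simps)
      then show ?thesis
        using k by simp
    qed (use const_bounds \<rho> in simp)
  qed
  then show ?thesis
    by blast
qed

end

text \<open>Collects what the later argument uses of the sum of bump differences.
  \<open>g_zero\<close> separates points only at the scale \<open>min e e'\<close>: if
  \<open>g\<close> vanishes along a whole forward orbit, this already places two points on a common
  local stable set.\<close>

locale transverse = smale +
  fixes g :: "'a \<Rightarrow> 'a \<Rightarrow> real" and \<eta> B L :: real
  assumes \<eta>: "0 < \<eta>" and B: "0 \<le> B" and L: "0 \<le> L" and g_nonneg: "0 \<le> g x y" and g_refl: "g x x = 0"
    and g_sym: "g x y = g y x" and g_triangle: "g x z \<le> g x y + g y z" and g_bound: "g x y \<le> B"
    and g_uniform: "0 < \<epsilon> \<Longrightarrow> \<exists>\<delta>>0. \<forall>x\<in>X. \<forall>y\<in>X. d x y \<le> \<delta> \<longrightarrow> g x y \<le> \<epsilon>"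
    and g_zero: "\<lbrakk>x \<in> X; y \<in> X; g x y = 0\<rbrakk> \<Longrightarrow> d x y \<le> min e e'"
    and g_stable: "\<lbrakk>x \<in> X; y \<in> S x \<eta>\<rbrakk> \<Longrightarrow> g x y = 0"
    and g_unstable: "\<lbrakk>y \<in> X; z \<in> X; (f ^^ n) z \<in> U ((f ^^ n) y) \<eta>\<rbrakk> \<Longrightarrow> g y z \<le> L * l ^ n"

section \<open>Summing finitely many bumps\<close>

context smale
begin

lemma finite_ball_cover:
  assumes "\<And>a. a \<in> X \<Longrightarrow> 0 < r a"
  obtains A where "finite A" "A \<subseteq> X" "\<And>x. x \<in> X \<Longrightarrow> \<exists>a\<in>A. d a x < r a"
proof -
  have "compactin mtopology X"
    using compact by (simp add: compact_space_def)
  moreover have "\<forall>V\<in>(\<lambda>a. mball a (r a)) ` X. openin mtopology V"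
    by auto
  moreover have "X \<subseteq> \<Union> ((\<lambda>a. mball a (r a)) ` X)"
    using assms by force
  ultimately obtain \<F> where "finite \<F>" "\<F> \<subseteq> (\<lambda>a. mball a (r a)) ` X" "X \<subseteq> \<Union> \<F>"
    unfolding compactin_def by meson
  then obtain A where "A \<subseteq> X" "finite A" "\<F> = (\<lambda>a. mball a (r a)) ` A"
    by (meson finite_subset_image)
  then have "x \<in> (\<Union>a\<in>A. mball a (r a))" if "x \<in> X" for x
    using \<open>X \<subseteq> \<Union> \<F>\<close> that by blast
  then have "\<exists>a\<in>A. d a x < r a" if "x \<in> X" for x
    using that by fastforce
  then show ?thesis
    using that \<open>A \<subseteq> X\<close> \<open>finite A\<close> by blast
qed

text \<open>Each bump is positive on a ball around its centre, and finitely many such balls cover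
  \<open>X\<close>. If all bumps agree at \<open>x\<close> and \<open>y\<close>, one of them is
  positive at both, so both lie in a support of radius \<open>\<epsilon>0 / 2\<close>. The other
  properties pass from the single bumps to the sum of their differences.\<close>

lemma transverse_ex:
  assumes td: "totally_disconnected_local_stable X d f e"
  shows "\<exists>g \<eta> B L. transverse X d f e e' l g \<eta> B L"
proof -
  define \<epsilon>0 where "\<epsilon>0 = min e e'"
  have "0 < \<epsilon>0 / 2"
    using const_bounds by (simp add: \<epsilon>0_def)
  then have "\<forall>a\<in>X. \<exists>\<phi> \<eta> R. bump a (\<epsilon>0 / 2) \<phi> \<eta> R"
    using local_bump[OF td] by blast
  then obtain \<phi> \<eta>' R where "\<And>a. a \<in> X \<Longrightarrow> bump a (\<epsilon>0 / 2) (\<phi> a) (\<eta>' a) (R a)"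
    by metis
  then have G: "0 < \<eta>' a" "0 \<le> R a" "0 \<le> \<phi> a x" "\<phi> a x \<le> 1" "\<phi> a a = 1" "0 < \<phi> a x \<Longrightarrow> d x a \<le> \<epsilon>0 / 2"
    "0 < \<epsilon> \<Longrightarrow> \<exists>\<delta>>0. \<forall>x\<in>X. \<forall>y\<in>X. d x y \<le> \<delta> \<longrightarrow> \<bar>\<phi> a x - \<phi> a y\<bar> \<le> \<epsilon>"
    "\<lbrakk>x \<in> X; y \<in> S x (\<eta>' a)\<rbrakk> \<Longrightarrow> \<phi> a x = \<phi> a y"
    "\<lbrakk>y \<in> X; z \<in> X; (f ^^ n) z \<in> U ((f ^^ n) y) (\<eta>' a)\<rbrakk> \<Longrightarrow> \<bar>\<phi> a y - \<phi> a z\<bar> \<le> R a * l ^ n"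
    if "a \<in> X" for a x y z n \<epsilon>
    using that unfolding bump_def by simp_all
  have "\<forall>a\<in>X. \<exists>r>0. \<forall>x\<in>X. d a x < r \<longrightarrow> 0 < \<phi> a x"
  proof
    fix a assume a: "a \<in> X"
    obtain \<delta> where \<delta>: "\<delta> > 0" "\<forall>x\<in>X. \<forall>y\<in>X. d x y \<le> \<delta> \<longrightarrow> \<bar>\<phi> a x - \<phi> a y\<bar> \<le> 1 / 2"
      using G(7)[OF a, of "1/2"] by auto
    have "0 < \<phi> a x" if x: "x \<in> X" "d a x < \<delta>" for x
    proof -
      have "\<bar>\<phi> a a - \<phi> a x\<bar> \<le> 1 / 2"
        using \<delta>(2) a x by simp
      then show ?thesis
        using G(5)[OF a] by linarith
    qed
    then show "\<exists>r>0. \<forall>x\<in>X. d a x < r \<longrightarrow> 0 < \<phi> a x"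
      using \<delta>(1) by blast
  qed
  then obtain r where r: "\<And>a. a \<in> X \<Longrightarrow> 0 < r a" "\<And>a x. \<lbrakk>a \<in> X; x \<in> X; d a x < r a\<rbrakk> \<Longrightarrow> 0 < \<phi> a x"
    by metis
  obtain A where A: "finite A" "A \<subseteq> X" "\<And>x. x \<in> X \<Longrightarrow> \<exists>a\<in>A. d a x < r a"
    by (rule finite_ball_cover[of r]) (use r in auto)
  \<comment> \<open>The entry 1 keeps the minimum defined when \<open>A\<close> is empty.\<close>
  define \<eta> where "\<eta> = Min (insert 1 (\<eta>' ` A))"
  have \<eta>: "0 < \<eta>" "a \<in> A \<Longrightarrow> \<eta> \<le> \<eta>' a" for a
    using A G(1) by (auto simp: \<eta>_def)
  define g where "g x y = (\<Sum>a\<in>A. \<bar>\<phi> a x - \<phi> a y\<bar>)" for x y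
  have "transverse X d f e e' l g \<eta> (real (card A)) (\<Sum>a\<in>A. R a)"
  proof unfold_locales
    show "0 < \<eta>" "0 \<le> real (card A)" "0 \<le> (\<Sum>a\<in>A. R a)"
      using \<eta> A G(2) by (auto intro!: sum_nonneg)
    show "0 \<le> g x y" "g x x = 0" "g x y = g y x" for x y
      by (auto simp: g_def abs_minus_commute intro!: sum_nonneg)
    show "g x z \<le> g x y + g y z" for x y z
      unfolding g_def sum.distrib[symmetric] by (intro sum_mono) linarith
    show "g x y \<le> real (card A)" for x y
    proof -
      have "\<bar>\<phi> a x - \<phi> a y\<bar> \<le> 1" if "a \<in> A" for a
        using G(3,4)[of a x] G(3,4)[of a y] A that by (auto simp: abs_le_iff)
      then show ?thesis
        unfolding g_def using sum_bounded_above[of A "\<lambda>a. \<bar>\<phi> a x - \<phi> a y\<bar>" 1] by simp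
    qed
    show "\<exists>\<delta>>0. \<forall>x\<in>X. \<forall>y\<in>X. d x y \<le> \<delta> \<longrightarrow> g x y \<le> \<epsilon>" if "0 < \<epsilon>" for \<epsilon> :: real
    proof -
      \<comment> \<open>The divisor is \<open>card A + 1\<close> so that it is positive for an empty
        family too.\<close>
      define \<epsilon>' where "\<epsilon>' = \<epsilon> / (real (card A) + 1)"
      have \<epsilon>': "0 < \<epsilon>'" "real (card A) * \<epsilon>' \<le> \<epsilon>"
        using that by (auto simp: \<epsilon>'_def field_simps)
      have "\<forall>a\<in>A. \<exists>\<delta>>0. \<forall>x\<in>X. \<forall>y\<in>X. d x y \<le> \<delta> \<longrightarrow> \<bar>\<phi> a x - \<phi> a y\<bar> \<le> \<epsilon>'"
        using G(7) \<epsilon>' A by blast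
      then obtain \<delta> where \<delta>: "\<And>a. a \<in> A \<Longrightarrow> 0 < \<delta> a"
        "\<And>a x y. \<lbrakk>a \<in> A; x \<in> X; y \<in> X; d x y \<le> \<delta> a\<rbrakk> \<Longrightarrow> \<bar>\<phi> a x - \<phi> a y\<bar> \<le> \<epsilon>'"
        by metis
      have "g x y \<le> \<epsilon>" if xy: "x \<in> X" "y \<in> X" "d x y \<le> Min (insert 1 (\<delta> ` A))" for x y
      proof -
        have "g x y \<le> real (card A) * \<epsilon>'"
          unfolding g_def using xy A by (intro sum_bounded_above \<delta>) auto
        then show ?thesis
          using \<epsilon>' by simp
      qed
      then show ?thesis
        using A \<delta>(1) by (intro exI[of _ "Min (insert 1 (\<delta> ` A))"]) auto
    qed
    show "d x y \<le> min e e'" if xy: "x \<in> X" "y \<in> X" "g x y = 0" for x y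
    proof -
      obtain a where a: "a \<in> A" "d a x < r a"
        using A(3) xy by blast
      then have aX: "a \<in> X"
        using A by blast
      have "\<bar>\<phi> a x - \<phi> a y\<bar> = 0"
        using xy(3) a A(1) unfolding g_def by (simp add: sum_nonneg_eq_0_iff)
      then have "0 < \<phi> a x" "0 < \<phi> a y"
        using r(2)[OF aX xy(1) a(2)] by auto
      then have "d x a \<le> \<epsilon>0 / 2" "d y a \<le> \<epsilon>0 / 2"
        using G(6)[OF aX] by blast+
      then show ?thesis
        using triangle[of x a y] xy aX commute[of a y] by (simp add: \<epsilon>0_def)
    qed
    show "g x y = 0" if xy: "x \<in> X" "y \<in> S x \<eta>" for x y
      unfolding g_def
    proof (rule sum.neutral, rule ballI)
      fix a assume a: "a \<in> A"
      show "\<bar>\<phi> a x - \<phi> a y\<bar> = 0"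
        using G(8)[of a x y] S_mono[OF xy(2) \<eta>(2)[OF a]] a A xy by auto
    qed
    show "g y z \<le> (\<Sum>a\<in>A. R a) * l ^ n" if yz: "y \<in> X" "z \<in> X" "(f ^^ n) z \<in> U ((f ^^ n) y) \<eta>" for y z n
      unfolding g_def sum_distrib_right
    proof (rule sum_mono)
      fix a assume a: "a \<in> A"
      show "\<bar>\<phi> a y - \<phi> a z\<bar> \<le> R a * l ^ n"
        using G(9)[of a y z n] U_mono[OF yz(3) \<eta>(2)[OF a]] a A yz by auto
    qed
  qed
  then show ?thesis
    by blast
qed

end

section \<open>The adapted pseudometric\<close>

context transverse
begin

definition D :: "'a \<Rightarrow> 'a \<Rightarrow> real" where
  "D x y = (SUP n. l ^ n * g ((f ^^ n) x) ((f ^^ n) y))"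

lemma D_term_le: "l ^ n * g ((f ^^ n) x) ((f ^^ n) y) \<le> l ^ n * B"
  using l_power[of n] g_bound by (intro mult_left_mono) auto

lemma D_bdd: "bdd_above (range (\<lambda>n. l ^ n * g ((f ^^ n) x) ((f ^^ n) y)))"
proof (rule bdd_aboveI2)
  fix n
  show "l ^ n * g ((f ^^ n) x) ((f ^^ n) y) \<le> B"
    using D_term_le[of n x y] mult_left_le_one_le[OF B, of "l ^ n"] l_power[of n] by linarith
qed

lemma D_upper: "l ^ n * g ((f ^^ n) x) ((f ^^ n) y) \<le> D x y"
  unfolding D_def by (rule cSUP_upper[OF UNIV_I D_bdd])

lemma D_least: "(\<And>n. l ^ n * g ((f ^^ n) x) ((f ^^ n) y) \<le> c) \<Longrightarrow> D x y \<le> c"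
  unfolding D_def by (rule cSUP_least) auto

lemma D_nonneg: "0 \<le> D x y"
  using D_upper[of 0 x y] g_nonneg[of x y] by simp

lemma D_refl: "D x x = 0"
  by (simp add: D_def g_refl)

lemma D_sym: "D x y = D y x"
  unfolding D_def by (subst g_sym) (rule refl)

lemma D_triangle: "D x z \<le> D x y + D y z"
proof (rule D_least)
  fix n
  have "l ^ n * g ((f ^^ n) x) ((f ^^ n) z) \<le> l ^ n * (g ((f ^^ n) x) ((f ^^ n) y) + g ((f ^^ n) y) ((f ^^ n) z))"
    using l_power[of n] g_triangle by (intro mult_left_mono) auto
  also have "\<dots> \<le> D x y + D y z"
    using D_upper[of n x y] D_upper[of n y z] by (simp add: distrib_left)
  finally show "l ^ n * g ((f ^^ n) x) ((f ^^ n) z) \<le> D x y + D y z" .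
qed

text \<open>Makes \<open>D\<close> well defined on classes of points at \<open>D\<close>-distance
  0.\<close>

lemma D_eq_of_zero:
  assumes "D x x' = 0" "D y y' = 0"
  shows "D x y = D x' y'"
  using D_triangle[of x y x'] D_triangle[of x' y y'] D_triangle[of x' y' x] D_triangle[of x y' y]
    D_sym[of x x'] D_sym[of y y'] assms by linarith

text \<open>The terms of the supremum for the images are those for \<open>x\<close> and
  \<open>y\<close> from index \<open>m\<close> on, divided by \<open>l ^ m\<close>.\<close>

lemma D_fn: "l ^ m * D ((f ^^ m) x) ((f ^^ m) y) \<le> D x y"
proof -
  have "D ((f ^^ m) x) ((f ^^ m) y) \<le> D x y / l ^ m"
  proof (rule D_least)
    fix n
    have "l ^ n * l ^ m * g ((f ^^ n) ((f ^^ m) x)) ((f ^^ n) ((f ^^ m) y)) \<le> D x y"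
      using D_upper[of "n + m" x y] by (simp add: power_add funpow_add)
    then show "l ^ n * g ((f ^^ n) ((f ^^ m) x)) ((f ^^ n) ((f ^^ m) y)) \<le> D x y / l ^ m"
      using l_power(1)[of m] by (simp add: field_simps)
  qed
  then show ?thesis
    using l_power(1)[of m] by (simp add: field_simps)
qed

lemma D_zero_fn: "D x y = 0 \<Longrightarrow> D ((f ^^ m) x) ((f ^^ m) y) = 0"
  using D_fn[of m x y] D_nonneg[of "(f ^^ m) x" "(f ^^ m) y"] l_power(1)[of m]
  by (simp add: mult_le_0_iff)

text \<open>All terms of the supremum vanish, so \<open>g_zero\<close> applies at every time of the
  forward orbit. Hence the classes of \<open>D\<close> lie in local stable sets.\<close>

lemma D_zero_stable:
  assumes "x \<in> X" "y \<in> X" "D x y = 0"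
  shows "y \<in> S x (min e e')"
proof -
  have "d ((f ^^ n) x) ((f ^^ n) y) \<le> min e e'" for n
  proof (rule g_zero)
    show "g ((f ^^ n) x) ((f ^^ n) y) = 0"
      using D_upper[of n x y] g_nonneg[of "(f ^^ n) x" "(f ^^ n) y"] l_power(1)[of n] assms(3)
      by (simp add: mult_le_0_iff)
  qed (use assms in auto)
  then show ?thesis
    using assms(2) by (simp add: local_stable_def)
qed

lemma D_stable:
  assumes "x \<in> X" "y \<in> S x \<eta>"
  shows "D x y = 0"
proof -
  have "g ((f ^^ n) x) ((f ^^ n) y) = 0" for n
  proof (rule g_stable)
    show "(f ^^ n) y \<in> S ((f ^^ n) x) \<eta>"
      unfolding local_stable_def
    proof (intro CollectI conjI allI)
      fix k
      show "d ((f ^^ k) ((f ^^ n) x)) ((f ^^ k) ((f ^^ n) y)) \<le> \<eta>"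
        using S_dist[OF assms(2), of "k + n"] by (simp add: funpow_add)
    qed (use assms S_in in auto)
  qed (use assms in auto)
  then show ?thesis
    by (simp add: D_def)
qed

text \<open>The weights make the terms of large index small whatever the points are; the finitely
  many others are controlled by uniform continuity of the iterates and by
  \<open>g_uniform\<close>.\<close>

lemma D_uniform:
  assumes "0 < \<epsilon>"
  obtains \<delta> where "0 < \<delta>" "\<And>x y. \<lbrakk>x \<in> X; y \<in> X; d x y \<le> \<delta>\<rbrakk> \<Longrightarrow> D x y \<le> \<epsilon>"
proof -
  \<comment> \<open>\<open>B + 1\<close> in place of \<open>B\<close> allows division when
    \<open>B\<close> is 0.\<close>
  obtain N where N: "l ^ N * (B + 1) < \<epsilon>"
  proof -
    obtain N where "l ^ N < \<epsilon> / (B + 1)"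
      using real_arch_pow_inv[of "\<epsilon> / (B + 1)" l] assms B const_bounds by auto
    then show ?thesis
      using that[of N] B by (simp add: field_simps)
  qed
  obtain \<delta>1 where \<delta>1: "0 < \<delta>1" "\<forall>x\<in>X. \<forall>y\<in>X. d x y \<le> \<delta>1 \<longrightarrow> g x y \<le> \<epsilon>"
    using g_uniform assms by blast
  obtain \<delta> where \<delta>: "0 < \<delta>" "\<And>x y j. \<lbrakk>x \<in> X; y \<in> X; d x y \<le> \<delta>; j \<le> N\<rbrakk> \<Longrightarrow> d ((f ^^ j) x) ((f ^^ j) y) \<le> \<delta>1"
    using uniform_f[OF \<delta>1(1)] by metis
  have "D x y \<le> \<epsilon>" if xy: "x \<in> X" "y \<in> X" "d x y \<le> \<delta>" for x y
  proof (rule D_least)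
    fix n
    show "l ^ n * g ((f ^^ n) x) ((f ^^ n) y) \<le> \<epsilon>"
    proof (cases "n \<le> N")
      case True
      then have "g ((f ^^ n) x) ((f ^^ n) y) \<le> \<epsilon>"
        using \<delta>1 \<delta> xy by simp
      then show ?thesis
        using mult_left_le_one_le[of "g ((f ^^ n) x) ((f ^^ n) y)" "l ^ n"] l_power[of n] g_nonneg
        by (smt (verit))
    next
      case False
      then have "l ^ n * B \<le> l ^ N * (B + 1)"
        using B const_bounds l_power[of N] by (intro mult_mono power_decreasing) auto
      then show ?thesis
        using D_term_le[of n x y] N by simp
    qed
  qed
  then show ?thesis
    using that \<delta> by blast
qed

lemma D_tendsto:
  assumes "\<And>n. u n \<in> X" "x \<in> X" "(\<lambda>n. d (u n) x) \<longlonglongrightarrow> 0"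
  shows "(\<lambda>n. D (u n) x) \<longlonglongrightarrow> 0"
proof (rule LIMSEQ_I)
  fix \<epsilon> :: real assume "0 < \<epsilon>"
  obtain \<delta> where \<delta>: "0 < \<delta>" "\<And>x y. \<lbrakk>x \<in> X; y \<in> X; d x y \<le> \<delta>\<rbrakk> \<Longrightarrow> D x y \<le> \<epsilon> / 2"
    by (rule D_uniform[of "\<epsilon> / 2"]) (use \<open>0 < \<epsilon>\<close> in auto)
  obtain N where "\<forall>n\<ge>N. d (u n) x < \<delta>"
    using LIMSEQ_D[OF assms(3) \<delta>(1)] by auto
  then have "\<forall>n\<ge>N. norm (D (u n) x - 0) < \<epsilon>"
    using \<delta>(2)[OF assms(1,2)] \<open>0 < \<epsilon>\<close> D_nonneg by (smt (verit) field_sum_of_halves real_norm_def)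
  then show "\<exists>N. \<forall>n\<ge>N. norm (D (u n) x - 0) < \<epsilon>" ..
qed

lemma D_tendsto2:
  assumes "\<And>n. u n \<in> X" "x \<in> X" "(\<lambda>n. d (u n) x) \<longlonglongrightarrow> 0"
    and "\<And>n. v n \<in> X" "y \<in> X" "(\<lambda>n. d (v n) y) \<longlonglongrightarrow> 0"
  shows "(\<lambda>n. D (u n) (v n)) \<longlonglongrightarrow> D x y"
proof (rule LIM_zero_cancel, rule Lim_null_comparison)
  show "(\<lambda>n. D (u n) x + D (v n) y) \<longlonglongrightarrow> 0"
    using tendsto_add[OF D_tendsto[OF assms(1-3)] D_tendsto[OF assms(4-6)]] by simp
  have "\<bar>D (u n) (v n) - D x y\<bar> \<le> D (u n) x + D (v n) y" for n
    using D_triangle[of "u n" "v n" x] D_triangle[of x "v n" y] D_triangle[of x y "u n"]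
      D_triangle[of "u n" y "v n"] D_sym[of x "u n"] D_sym[of y "v n"] by linarith
  then show "\<forall>\<^sub>F n in sequentially. norm (D (u n) (v n) - D x y) \<le> D (u n) x + D (v n) y"
    by simp
qed

text \<open>For \<open>j \<le> n\<close> the weight \<open>l ^ j\<close> multiplies a value of
  \<open>g\<close> that is at most \<open>L * l ^ (n - j)\<close>. For \<open>j > n\<close> the
  weight alone, with the bound \<open>B\<close> on \<open>g\<close>, suffices. This explains the
  constant \<open>L + B\<close>.\<close>

lemma D_unstable_upper:
  assumes "y \<in> X" "z \<in> X" "(f ^^ n) z \<in> U ((f ^^ n) y) \<eta>"
  shows "D y z \<le> (L + B) * l ^ n"
proof (rule D_least)
  fix j
  show "l ^ j * g ((f ^^ j) y) ((f ^^ j) z) \<le> (L + B) * l ^ n"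
  proof (cases "j \<le> n")
    case True
    have "(f ^^ (n - j)) ((f ^^ j) x) = (f ^^ n) x" for x
      using funpow_add[of "n - j" j f] True by simp
    then have "g ((f ^^ j) y) ((f ^^ j) z) \<le> L * l ^ (n - j)"
      using assms by (intro g_unstable) auto
    then have "l ^ j * g ((f ^^ j) y) ((f ^^ j) z) \<le> l ^ j * (L * l ^ (n - j))"
      using l_power(1)[of j] by (intro mult_left_mono) auto
    also have "\<dots> = L * l ^ n"
      using True power_add[of l j "n - j"] by simp
    also have "\<dots> \<le> (L + B) * l ^ n"
      using B l_power[of n] by (intro mult_right_mono) auto
    finally show ?thesis .
  next
    case False
    have "l ^ j * B \<le> l ^ n * (L + B)"
      using False B L const_bounds by (intro mult_mono power_decreasing) auto
    then show ?thesis
      using D_term_le[of j y z] by (simp add: mult.commute)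
  qed
qed

text \<open>Both sides are comparable to \<open>l\<close> raised to the time at which the forward orbits separate.\<close>

lemma D_expand:
  obtains r C where "0 < r" "0 < C"
    "\<And>y z m. \<lbrakk>y \<in> X; z \<in> X; (f ^^ m) z \<in> U ((f ^^ m) y) r\<rbrakk> \<Longrightarrow> D y z \<le> C * l ^ m * D ((f ^^ m) y) ((f ^^ m) z)"
proof -
  obtain \<delta> where \<delta>: "0 < \<delta>" "\<And>x y j. \<lbrakk>x \<in> X; y \<in> X; d x y \<le> \<delta>; j \<le> 1\<rbrakk> \<Longrightarrow> d ((f ^^ j) x) ((f ^^ j) y) \<le> e'"
    using uniform_f[OF const_bounds(2)] by metis
  \<comment> \<open>The bound by \<open>\<delta>\<close> ensures that orbits within \<open>r\<close>
    of each other are still within \<open>e'\<close> one step later, hence also at the time of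
    separation.\<close>
  define r where "r = min (min \<eta> e') \<delta>"
  have r: "0 < r" "r \<le> \<eta>" "r \<le> e'" "r \<le> \<delta>"
    using \<eta> const_bounds \<delta> by (auto simp: r_def)
  \<comment> \<open>Otherwise a limit pair would have \<open>D\<close>-distance 0 while at distance
    at least \<open>r\<close> and on a common local unstable set. By \<open>D_zero_stable\<close> it
    would lie on a common local stable set as well, and then the two points coincide.\<close>
  have "\<exists>c>0. \<forall>y\<in>X. \<forall>z\<in>U y e'. r \<le> d y z \<longrightarrow> c \<le> D y z"
  proof (rule ccontr)
    assume n: "\<not> ?thesis"
    have "\<exists>y z. y \<in> X \<and> z \<in> U y e' \<and> r \<le> d y z \<and> D y z \<le> inverse (real (Suc k))" for k
    proof -
      have "0 < inverse (real (Suc k))"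
        by simp
      then have "\<not> (\<forall>y\<in>X. \<forall>z\<in>U y e'. r \<le> d y z \<longrightarrow> inverse (real (Suc k)) \<le> D y z)"
        using n by blast
      then show ?thesis
        by (meson linear)
    qed
    then obtain u v where uv: "\<And>k. u k \<in> X" "\<And>k. v k \<in> U (u k) e'" "\<And>k. r \<le> d (u k) (v k)"
      "\<And>k. D (u k) (v k) \<le> inverse (real (Suc k))"
      by metis
    obtain x y t where t: "x \<in> X" "y \<in> X" "strict_mono (t :: nat \<Rightarrow> nat)"
      "(\<lambda>n. d (u (t n)) x) \<longlonglongrightarrow> 0" "(\<lambda>n. d (v (t n)) y) \<longlonglongrightarrow> 0"
      by (rule compact_subseq2[OF compact uv(1) U_in[OF uv(2)]])
    have "y \<in> U x e'"
      by (rule U_limit[OF uv(1) t(1,2,4,5) uv(2)])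
    have "r \<le> d x y"
      using LIMSEQ_le_const[OF dist_tendsto[OF uv(1) U_in[OF uv(2)] t(1,2,4,5)]] uv(3) by blast
    have "(\<lambda>n. D (u n) (v n)) \<longlonglongrightarrow> 0"
      using uv(4) D_nonneg by (intro tendsto_0_le_inverse_Suc) auto
    from LIMSEQ_subseq_LIMSEQ[OF this t(3)] have "(\<lambda>n. D (u (t n)) (v (t n))) \<longlonglongrightarrow> 0"
      by (simp add: o_def)
    moreover have "(\<lambda>n. D (u (t n)) (v (t n))) \<longlonglongrightarrow> D x y"
      by (rule D_tendsto2[OF uv(1) t(1,4) U_in[OF uv(2)] t(2,5)])
    ultimately have "D x y = 0"
      using LIMSEQ_unique by blast
    then have "y \<in> S x e'"
      using D_zero_stable[OF t(1,2)] by (auto intro: S_mono)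
    then have "y = x"
      using S_U_eq[OF t(1)] \<open>y \<in> U x e'\<close> by blast
    then show False
      using \<open>r \<le> d x y\<close> r t by simp
  qed
  then obtain c where c: "0 < c" "\<And>y z. \<lbrakk>y \<in> X; z \<in> U y e'; r \<le> d y z\<rbrakk> \<Longrightarrow> c \<le> D y z"
    by blast
  \<comment> \<open>Quotient of the upper bound \<open>(L + B + 1) * l ^ (k + m)\<close> for
    \<open>D y z\<close> by the lower bound \<open>l ^ N * c\<close> for the distance of the images,
    up to \<open>l ^ m\<close>; the factor \<open>l\<close> comes from \<open>N = k + 1\<close>. The
    summand 1 keeps \<open>C\<close> positive if \<open>L + B\<close> is 0.\<close>
  define C where "C = (L + B + 1) / (c * l)"
  have C: "0 < C"
    using L B c const_bounds by (simp add: C_def)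
  show ?thesis
  proof (rule that[of r C])
    fix y z m
    assume y: "y \<in> X" and z: "z \<in> X" and m: "(f ^^ m) z \<in> U ((f ^^ m) y) r"
    let ?y = "(f ^^ m) y" and ?z = "(f ^^ m) z"
    have X: "?y \<in> X" "?z \<in> X"
      using y z by auto
    show "D y z \<le> C * l ^ m * D ?y ?z"
    proof (cases "?y = ?z")
      case True
      then have "y = z"
        using y z Fn_fn by metis
      then show ?thesis
        by (simp add: D_refl)
    next
      case False
      have "\<exists>n. r < d ((f ^^ n) ?y) ((f ^^ n) ?z)"
      proof (rule ccontr)
        assume "\<not> ?thesis"
        then have "?z \<in> S ?y e'"
          using X r by (force simp: local_stable_def not_less intro: order_trans)
        moreover have "?z \<in> U ?y e'"
          using m r U_mono by blast
        ultimately show False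
          using S_U_eq X False by metis
      qed
      \<comment> \<open>\<open>N\<close> is the first time at which the orbits of the images are
        more than \<open>r\<close> apart. It is positive because the images start within
        \<open>r\<close>; the upper bound on \<open>D\<close> is taken at time \<open>k\<close>, one
        step earlier, and the lower bound at time \<open>N\<close>.\<close>
      then obtain N where N: "r < d ((f ^^ N) ?y) ((f ^^ N) ?z)" "\<And>j. j < N \<Longrightarrow> d ((f ^^ j) ?y) ((f ^^ j) ?z) \<le> r"
        using exists_least_iff[of "\<lambda>n. r < d ((f ^^ n) ?y) ((f ^^ n) ?z)"] by (auto simp: not_less)
      have "N \<noteq> 0"
        using N(1) U_dist0[OF m] by (cases N) auto
      then obtain k where k: "N = Suc k"
        using not0_implies_Suc by blast
      have "(f ^^ k) ?z \<in> U ((f ^^ k) ?y) r"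
        using N k by (intro unstable_image[OF X _ m]) auto
      then have "(f ^^ (k + m)) z \<in> U ((f ^^ (k + m)) y) \<eta>"
        using r U_mono by (simp add: funpow_add)
      then have "D y z \<le> (L + B) * l ^ (k + m)"
        using y z by (intro D_unstable_upper) auto
      also have "\<dots> \<le> (L + B + 1) * l ^ (k + m)"
        using l_power[of "k + m"] by (intro mult_right_mono) auto
      also have "\<dots> = C * l ^ m * (l ^ N * c)"
        using c const_bounds by (simp add: C_def k power_add)
      also have "\<dots> \<le> C * l ^ m * D ?y ?z"
      proof (rule mult_left_mono)
        have dN: "d ((f ^^ j) ?y) ((f ^^ j) ?z) \<le> e'" if "j \<le> N" for j
        proof (cases "j = N")
          case True
          show ?thesis
            using \<delta>(2)[of "(f ^^ k) ?y" "(f ^^ k) ?z" 1] N(2)[of k] X r k True by simp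
        qed (use N(2)[of j] r that in simp)
        have "(f ^^ N) ?z \<in> U ((f ^^ N) ?y) e'"
          by (rule unstable_image[OF X dN U_mono[OF m r(3)]])
        then have "c \<le> D ((f ^^ N) ?y) ((f ^^ N) ?z)"
          using c(2) X N by simp
        then have "l ^ N * c \<le> l ^ N * D ((f ^^ N) ?y) ((f ^^ N) ?z)"
          using l_power(1)[of N] by (intro mult_left_mono) auto
        then show "l ^ N * c \<le> D ?y ?z"
          using D_fn[of N ?y ?z] by simp
        show "0 \<le> C * l ^ m"
          using C l_power[of m] by simp
      qed
      finally show ?thesis .
    qed
  qed (use r C in auto)
qed

text \<open>Points at small \<open>D\<close>-distance may be far apart, as a class can contain
  distant points. Compactness only gives a pair in one class close to the given pair: a sequence of
  counterexamples would accumulate at such a pair.\<close>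

lemma D_near_zero:
  assumes "0 < \<rho>"
  obtains \<beta> where "0 < \<beta>" "\<And>x y. \<lbrakk>x \<in> X; y \<in> X; D x y \<le> \<beta>\<rbrakk> \<Longrightarrow>
    \<exists>x'\<in>X. \<exists>y'\<in>X. D x' y' = 0 \<and> d x x' \<le> \<rho> \<and> d y y' \<le> \<rho>"
proof -
  let ?P = "\<lambda>x y. \<exists>x'\<in>X. \<exists>y'\<in>X. D x' y' = 0 \<and> d x x' \<le> \<rho> \<and> d y y' \<le> \<rho>"
  have "\<exists>\<beta>>0. \<forall>x\<in>X. \<forall>y\<in>X. D x y \<le> \<beta> \<longrightarrow> ?P x y"
  proof (rule ccontr)
    assume n: "\<not> ?thesis"
    have "\<exists>x y. x \<in> X \<and> y \<in> X \<and> D x y \<le> inverse (real (Suc k)) \<and> \<not> ?P x y" for k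
    proof -
      have "0 < inverse (real (Suc k))"
        by simp
      then show ?thesis
        using n by blast
    qed
    then obtain u v where uv: "\<And>k. u k \<in> X" "\<And>k. v k \<in> X" "\<And>k. D (u k) (v k) \<le> inverse (real (Suc k))"
      "\<And>k. \<not> ?P (u k) (v k)"
      by metis
    obtain x y t where t: "x \<in> X" "y \<in> X" "strict_mono (t :: nat \<Rightarrow> nat)"
      "(\<lambda>n. d (u (t n)) x) \<longlonglongrightarrow> 0" "(\<lambda>n. d (v (t n)) y) \<longlonglongrightarrow> 0"
      by (rule compact_subseq2[OF compact uv(1,2)])
    have "(\<lambda>n. D (u n) (v n)) \<longlonglongrightarrow> 0"
      using uv(3) D_nonneg by (intro tendsto_0_le_inverse_Suc) auto
    from LIMSEQ_subseq_LIMSEQ[OF this t(3)] have "(\<lambda>n. D (u (t n)) (v (t n))) \<longlonglongrightarrow> 0"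
      by (simp add: o_def)
    moreover have "(\<lambda>n. D (u (t n)) (v (t n))) \<longlonglongrightarrow> D x y"
      by (rule D_tendsto2[OF uv(1) t(1,4) uv(2) t(2,5)])
    ultimately have "D x y = 0"
      using LIMSEQ_unique by blast
    moreover have "\<forall>\<^sub>F n in sequentially. d (u (t n)) x < \<rho> \<and> d (v (t n)) y < \<rho>"
      using order_tendstoD(2)[OF t(4) assms] order_tendstoD(2)[OF t(5) assms] by (rule eventually_conj)
    then obtain n where "d (u (t n)) x < \<rho> \<and> d (v (t n)) y < \<rho>"
      using eventually_happens'[OF sequentially_bot] by blast
    ultimately have "?P (u (t n)) (v (t n))"
      using t(1,2) less_imp_le by blast
    then show False
      using uv(4) by blast
  qed
  then show ?thesis
    using that by blast
qed

text \<open>Two nearby classes may come from distant points of a third class; their images under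
  \<open>f ^^ K\<close> are close because \<open>f ^^ K\<close> contracts that class.\<close>

lemma close_bracket:
  obtains K0 where "\<And>K r. \<lbrakk>K0 \<le> K; 0 < r\<rbrakk> \<Longrightarrow> \<exists>\<beta>>0. \<forall>x\<in>X. \<forall>y\<in>X. D x y \<le> \<beta> \<longrightarrow>
    (\<exists>z. z \<in> S ((f ^^ K) x) \<eta> \<and> z \<in> U ((f ^^ K) y) r)"
proof -
  let ?m = "min e e'"
  have m: "0 < ?m"
    using const_bounds by simp
  \<comment> \<open>From time \<open>K0\<close> on, points of one class, which are at most
    \<open>min e e'\<close> apart, are mapped to within \<open>\<eta> / 2\<close> and
    \<open>e / 2\<close> of each other. \<open>K0\<close> does not involve \<open>r\<close>, so a
    later choice of \<open>r\<close> may depend on \<open>K\<close>.\<close>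
  obtain K0 where K0: "l ^ K0 < min (\<eta> / 2) (e / 2) / ?m"
    using real_arch_pow_inv[of "min (\<eta> / 2) (e / 2) / ?m" l] \<eta> const_bounds by auto
  show ?thesis
  proof (rule that[of K0])
    fix K r
    assume K: "K0 \<le> K" and r: "(0::real) < r"
    have "l ^ K \<le> l ^ K0"
      using K const_bounds by (intro power_decreasing) auto
    then have "l ^ K < min (\<eta> / 2) (e / 2) / ?m"
      using K0 by linarith
    then have lK: "l ^ K * ?m \<le> \<eta> / 2" "l ^ K * ?m \<le> e / 2"
      using m by (simp_all add: pos_less_divide_eq)
    define \<epsilon> where "\<epsilon> = min (\<eta> / 4) (r / 2)"
    have \<epsilon>: "0 < \<epsilon>" "\<epsilon> \<le> \<eta> / 4" "\<epsilon> \<le> r / 2"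
      using \<eta> r by (auto simp: \<epsilon>_def)
    obtain \<delta>1 where \<delta>1: "0 < \<delta>1" "\<And>x y x' y' z z'. \<lbrakk>x \<in> X; y \<in> X; x' \<in> X; y' \<in> X; d x y \<le> e; d x' y' \<le> e;
      d x x' \<le> \<delta>1; d y y' \<le> \<delta>1; z \<in> S x e'; z \<in> U y e'; z' \<in> S x' e'; z' \<in> U y' e'\<rbrakk> \<Longrightarrow> d z z' \<le> \<epsilon>"
      by (rule bracket_uniform[OF \<epsilon>(1)]) blast
    define \<delta> where "\<delta> = min (min \<delta>1 \<epsilon>) (e / 4)"
    have \<delta>: "0 < \<delta>" "\<delta> \<le> \<delta>1" "\<delta> \<le> \<epsilon>" "\<delta> \<le> e / 4"
      using \<delta>1 \<epsilon> const_bounds by (auto simp: \<delta>_def)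
    obtain \<rho> where \<rho>: "0 < \<rho>" "\<And>x y j. \<lbrakk>x \<in> X; y \<in> X; d x y \<le> \<rho>; j \<le> K\<rbrakk> \<Longrightarrow> d ((f ^^ j) x) ((f ^^ j) y) \<le> \<delta>"
      by (rule uniform_f[OF \<delta>(1)]) blast
    obtain \<beta> where \<beta>: "0 < \<beta>" "\<And>x y. \<lbrakk>x \<in> X; y \<in> X; D x y \<le> \<beta>\<rbrakk> \<Longrightarrow>
      \<exists>x'\<in>X. \<exists>y'\<in>X. D x' y' = 0 \<and> d x x' \<le> \<rho> \<and> d y y' \<le> \<rho>"
      by (rule D_near_zero[OF \<rho>(1)]) blast
    have "\<exists>z. z \<in> S ((f ^^ K) x) \<eta> \<and> z \<in> U ((f ^^ K) y) r" if x: "x \<in> X" and y: "y \<in> X" and xy: "D x y \<le> \<beta>" for x y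
    proof -
      obtain x' y' where x': "x' \<in> X" "d x x' \<le> \<rho>" and y': "y' \<in> X" "d y y' \<le> \<rho>" and 0: "D x' y' = 0"
        using \<beta>(2)[OF x y xy] by blast
      define a b a' b' where ab: "a = (f ^^ K) x" "b = (f ^^ K) y" "a' = (f ^^ K) x'" "b' = (f ^^ K) y'"
      have X: "a \<in> X" "b \<in> X" "a' \<in> X" "b' \<in> X"
        using x y x' y' by (auto simp: ab)
      have aa': "d a a' \<le> \<delta>" "d b b' \<le> \<delta>"
        using \<rho>(2) x x' y y' by (simp_all add: ab)
      have st: "y' \<in> S x' ?m"
        using D_zero_stable x' y' 0 by blast
      have "d a' b' \<le> l ^ K * d x' y'"
        unfolding ab using x' S_mono[OF st, of e'] by (intro S_contract) auto
      also have "\<dots> \<le> l ^ K * ?m"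
        using S_dist0[OF st] l_power[of K] by (intro mult_left_mono) auto
      finally have a'b': "d a' b' \<le> \<eta> / 2" "d a' b' \<le> e / 2"
        using lK by linarith+
      have "d a b \<le> d a a' + d a' b' + d b b'"
        using triangle[of a a' b] triangle[of a' b' b] X commute[of b b'] by simp
      then have "d a b \<le> e"
        using aa' a'b' \<delta> by linarith
      then obtain z where z: "z \<in> S a e'" "z \<in> U b e'"
        using bracket_ex X by blast
      \<comment> \<open>The images of the class pair share a stable set, so the bracket of
        \<open>a'\<close> and \<open>b'\<close> is \<open>b'\<close>. By uniform continuity
        \<open>z\<close>, the bracket of the nearby points \<open>a\<close> and \<open>b\<close>, is
        close to \<open>b'\<close>.\<close>
      have "b' \<in> S a' e'"
      proof -
        have "d ((f ^^ n) a') ((f ^^ n) b') \<le> e'" for n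
          using S_dist[OF st, of "n + K"] by (simp add: ab funpow_add)
        then show ?thesis
          using X by (simp add: local_stable_def)
      qed
      moreover have "b' \<in> U b' e'"
        using X const_bounds by (intro U_self) auto
      ultimately have zb': "d z b' \<le> \<epsilon>"
        using \<delta>1(2)[OF X(1,2,3,4) \<open>d a b \<le> e\<close> _ _ _ z] aa' a'b' \<delta> const_bounds by simp
      have zX: "z \<in> X"
        using z S_in by blast
      have "d b z \<le> d b b' + d z b'" "d a z \<le> d a a' + d a' b' + d z b'"
        using triangle[of b b' z] triangle[of a a' z] triangle[of a' b' z] X zX commute[of b' z] by simp_all
      then have "d b z \<le> r" "d a z \<le> \<eta>"
        using zb' aa' a'b' \<epsilon> \<delta> by linarith+
      then show ?thesis
        using S_shrink[OF X(1) z(1)] U_shrink[OF X(2) z(2)] by (auto simp: ab)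
    qed
    then show "\<exists>\<beta>>0. \<forall>x\<in>X. \<forall>y\<in>X. D x y \<le> \<beta> \<longrightarrow> (\<exists>z. z \<in> S ((f ^^ K) x) \<eta> \<and> z \<in> U ((f ^^ K) y) r)"
      using \<beta>(1) by blast
  qed
qed

text \<open>Images under \<open>f ^^ K\<close> of \<open>D\<close>-close points can be moved within
  their classes onto a common local unstable set, where \<open>D_expand\<close> applies; moving
  within a class does not affect \<open>D\<close>. Axiom 1 compares times \<open>K\<close> and
  \<open>2 * K\<close>. For Axiom 2 the moved point is pulled back by \<open>2 * K\<close>
  steps.\<close>

lemma adapted_axioms:
  obtains \<beta> \<gamma> and K :: nat where "0 < \<beta>" "1 \<le> K" "0 < \<gamma>" "\<gamma> < 1"
    "\<And>x y. \<lbrakk>x \<in> X; y \<in> X; D x y \<le> \<beta>\<rbrakk> \<Longrightarrow>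
      D ((f ^^ K) x) ((f ^^ K) y) \<le> \<gamma> ^ K * D ((f ^^ (2 * K)) x) ((f ^^ (2 * K)) y)"
    "\<And>x w \<epsilon>. \<lbrakk>x \<in> X; w \<in> X; \<epsilon> \<le> \<beta>; D ((f ^^ K) x) w \<le> \<epsilon>\<rbrakk> \<Longrightarrow>
      \<exists>v\<in>X. D x v \<le> \<gamma> * \<epsilon> \<and> D ((f ^^ (2 * K)) v) ((f ^^ K) w) = 0"
proof -
  obtain r C where r: "0 < r" and C: "0 < C"
    "\<And>y z m. \<lbrakk>y \<in> X; z \<in> X; (f ^^ m) z \<in> U ((f ^^ m) y) r\<rbrakk> \<Longrightarrow> D y z \<le> C * l ^ m * D ((f ^^ m) y) ((f ^^ m) z)"
    using D_expand by metis
  obtain K0 where K0: "\<And>K r. \<lbrakk>K0 \<le> K; 0 < r\<rbrakk> \<Longrightarrow> \<exists>\<beta>>0. \<forall>x\<in>X. \<forall>y\<in>X. D x y \<le> \<beta> \<longrightarrow>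
    (\<exists>z. z \<in> S ((f ^^ K) x) \<eta> \<and> z \<in> U ((f ^^ K) y) r)"
    using close_bracket by metis
  \<comment> \<open>The square root splits \<open>l ^ K\<close> into two factors
    \<open>\<gamma> ^ K\<close>; for large \<open>K\<close> one of them absorbs the constant
    \<open>C\<close>, and the other is the contraction rate of the axioms.\<close>
  define \<gamma> where "\<gamma> = sqrt l"
  have \<gamma>: "0 < \<gamma>" "\<gamma> < 1" "\<gamma> * \<gamma> = l"
    using const_bounds by (auto simp: \<gamma>_def)
  obtain K1 where K1: "\<gamma> ^ K1 < 1 / C"
    using real_arch_pow_inv[of "1 / C" \<gamma>] \<gamma> C by auto
  define K where "K = Suc (max K0 K1)"
  have K: "1 \<le> K" "K0 \<le> K" "K1 \<le> K"
    by (auto simp: K_def)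
  have "\<gamma> ^ K \<le> \<gamma> ^ K1"
    using K \<gamma> by (intro power_decreasing) auto
  then have "C * \<gamma> ^ K \<le> C * \<gamma> ^ K1"
    using C(1) by (intro mult_left_mono) auto
  also have "\<dots> \<le> 1"
    using K1 C(1) by (simp add: field_simps)
  finally have "C * \<gamma> ^ K \<le> 1" .
  moreover have lK: "l ^ K = \<gamma> ^ K * \<gamma> ^ K"
    using \<gamma>(3) by (metis power_mult_distrib)
  ultimately have CK: "C * l ^ K \<le> \<gamma> ^ K"
    using mult_right_mono[of "C * \<gamma> ^ K" 1 "\<gamma> ^ K"] \<gamma> by (simp add: mult.assoc)
  have "\<gamma> ^ K \<le> \<gamma> ^ 1"
    using K \<gamma> by (intro power_decreasing) auto
  then have CK': "C * l ^ K \<le> \<gamma>"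
    using CK by simp
  \<comment> \<open>The bracket is formed at time \<open>K\<close>, but expansion needs unstable
    closeness \<open>r\<close> at time \<open>2 * K\<close>; starting within \<open>r'\<close>
    guarantees it for \<open>K\<close> more steps.\<close>
  obtain r' where r': "0 < r'" "r' \<le> r" "\<And>x y j. \<lbrakk>x \<in> X; y \<in> X; d x y \<le> r'; j \<le> K\<rbrakk> \<Longrightarrow> d ((f ^^ j) x) ((f ^^ j) y) \<le> r"
  proof -
    obtain \<delta> where "0 < \<delta>" "\<And>x y j. \<lbrakk>x \<in> X; y \<in> X; d x y \<le> \<delta>; j \<le> K\<rbrakk> \<Longrightarrow> d ((f ^^ j) x) ((f ^^ j) y) \<le> r"
      by (rule uniform_f[OF r]) blast
    then show ?thesis
      using that[of "min \<delta> r"] r by auto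
  qed
  obtain \<beta> where \<beta>: "0 < \<beta>" "\<And>x y. \<lbrakk>x \<in> X; y \<in> X; D x y \<le> \<beta>\<rbrakk> \<Longrightarrow>
      \<exists>z. z \<in> S ((f ^^ K) x) \<eta> \<and> z \<in> U ((f ^^ K) y) r'"
    using K0[OF K(2) r'(1)] by blast
  show ?thesis
  proof (rule that[of \<beta> K \<gamma>])
    fix x y
    assume x: "x \<in> X" and y: "y \<in> X" and xy: "D x y \<le> \<beta>"
    obtain z where z: "z \<in> S ((f ^^ K) x) \<eta>" "z \<in> U ((f ^^ K) y) r'"
      using \<beta>(2)[OF x y xy] by blast
    have zX: "z \<in> X"
      using z S_in by blast
    have 0: "D ((f ^^ K) x) z = 0"
      using D_stable x z by simp
    have K2: "(f ^^ (2 * K)) u = (f ^^ K) ((f ^^ K) u)" for u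
      by (simp add: mult_2 funpow_add)
    have "(f ^^ K) z \<in> U ((f ^^ K) ((f ^^ K) y)) r"
      using zX y r' U_dist0[OF z(2)] U_mono[OF z(2) r'(2)] by (intro unstable_image) auto
    then have "D ((f ^^ K) y) z \<le> C * l ^ K * D ((f ^^ (2 * K)) y) ((f ^^ K) z)"
      unfolding K2 using C(2) zX y by simp
    also have "\<dots> \<le> \<gamma> ^ K * D ((f ^^ (2 * K)) y) ((f ^^ K) z)"
      using CK D_nonneg by (intro mult_right_mono) auto
    \<comment> \<open>As \<open>z\<close> and \<open>(f ^^ K) x\<close> lie in one class, so do
      their images, and \<open>z\<close> can be replaced in both distances.\<close>
    also have "D ((f ^^ (2 * K)) y) ((f ^^ K) z) = D ((f ^^ (2 * K)) x) ((f ^^ (2 * K)) y)"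
      using D_eq_of_zero[OF D_zero_fn[OF 0, of K] D_refl] D_sym unfolding K2 by metis
    also have "D ((f ^^ K) y) z = D ((f ^^ K) x) ((f ^^ K) y)"
      using D_eq_of_zero[OF 0 D_refl] D_sym by metis
    finally show "D ((f ^^ K) x) ((f ^^ K) y) \<le> \<gamma> ^ K * D ((f ^^ (2 * K)) x) ((f ^^ (2 * K)) y)" .
  next
    fix x w \<epsilon>
    assume x: "x \<in> X" and w: "w \<in> X" and \<epsilon>: "\<epsilon> \<le> \<beta>" and xw: "D ((f ^^ K) x) w \<le> \<epsilon>"
    have K2: "(f ^^ (2 * K)) u = (f ^^ K) ((f ^^ K) u)" for u
      by (simp add: mult_2 funpow_add)
    have "D w ((f ^^ K) x) \<le> \<beta>"
      using \<epsilon> xw D_sym[of w] by simp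
    then obtain z where z: "z \<in> S ((f ^^ K) w) \<eta>" "z \<in> U ((f ^^ K) ((f ^^ K) x)) r'"
      using \<beta>(2)[of w "(f ^^ K) x"] x w by auto
    have zX: "z \<in> X"
      using z S_in by blast
    \<comment> \<open>\<open>z\<close> lies on the unstable set of \<open>(f ^^ (2 * K)) x\<close>,
      so going back \<open>2 * K\<close> steps gains \<open>C * l ^ (2 * K)\<close>. One factor
      \<open>l ^ K\<close> pays for the expansion of \<open>D\<close> from time \<open>K\<close> to
      time \<open>2 * K\<close>, and the remaining \<open>C * l ^ K\<close> is at most
      \<open>\<gamma>\<close>.\<close>
    define v where "v = (F ^^ (2 * K)) z"
    have v: "v \<in> X" "(f ^^ (2 * K)) v = z"
      using zX by (auto simp: v_def)
    have 0: "D ((f ^^ K) w) z = 0"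
      using D_stable w z by simp
    have "D x v \<le> C * l ^ (2 * K) * D ((f ^^ (2 * K)) x) ((f ^^ (2 * K)) v)"
      using x v U_mono[OF z(2) r'(2)] by (intro C(2)) (auto simp: K2[of x])
    also have "D ((f ^^ (2 * K)) x) ((f ^^ (2 * K)) v) = D ((f ^^ K) ((f ^^ K) x)) ((f ^^ K) w)"
      unfolding v(2) K2[of x] using D_eq_of_zero[OF D_refl 0] by metis
    also have "C * l ^ (2 * K) * D ((f ^^ K) ((f ^^ K) x)) ((f ^^ K) w) =
        C * l ^ K * (l ^ K * D ((f ^^ K) ((f ^^ K) x)) ((f ^^ K) w))"
      by (simp add: mult_2 power_add)
    also have "\<dots> \<le> \<gamma> * \<epsilon>"
      using CK' D_fn[of K "(f ^^ K) x" w] xw D_nonneg l_power[of K] \<gamma> by (intro mult_mono) auto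
    finally show "\<exists>v\<in>X. D x v \<le> \<gamma> * \<epsilon> \<and> D ((f ^^ (2 * K)) v) ((f ^^ K) w) = 0"
      using v 0 D_sym by metis
  qed (use \<beta> K \<gamma> in auto)
qed

end

section \<open>The quotient system and its inverse limit\<close>

context transverse
begin

section \<open>The quotient by points at \<open>D\<close>-distance 0\<close>

definition cls :: "'a \<Rightarrow> 'a set" where
  "cls x = {y \<in> X. D x y = 0}"

definition rep :: "'a set \<Rightarrow> 'a" where
  "rep P = (SOME x. x \<in> P)"

definition Y :: "'a set set" where
  "Y = cls ` X"

text \<open>Using chosen representatives makes nonnegativity and symmetry hold for arbitrary sets,
  as \<open>Metric_space\<close> demands; on \<open>Y\<close> the choice does not matter.\<close>

definition \<Delta> :: "'a set \<Rightarrow> 'a set \<Rightarrow> real" where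
  "\<Delta> P Q = D (rep P) (rep Q)"

definition \<alpha> :: "'a set \<Rightarrow> 'a set" where
  "\<alpha> P = cls (f (rep P))"

definition \<omega> :: "'a \<Rightarrow> nat \<Rightarrow> 'a set" where
  "\<omega> x n = cls ((F ^^ n) x)"

lemma rep_cls:
  assumes "x \<in> X"
  shows "rep (cls x) \<in> X" "D x (rep (cls x)) = 0"
proof -
  have "x \<in> cls x"
    using assms by (simp add: cls_def D_refl)
  then have "rep (cls x) \<in> cls x"
    unfolding rep_def by (rule someI)
  then show "rep (cls x) \<in> X" "D x (rep (cls x)) = 0"
    by (simp_all add: cls_def)
qed

lemma \<Delta>_cls: "\<lbrakk>x \<in> X; y \<in> X\<rbrakk> \<Longrightarrow> \<Delta> (cls x) (cls y) = D x y"
  using D_eq_of_zero[of x "rep (cls x)" y "rep (cls y)"] by (simp add: \<Delta>_def rep_cls)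

lemma cls_eq:
  assumes "x \<in> X" "y \<in> X"
  shows "cls x = cls y \<longleftrightarrow> D x y = 0"
proof
  assume "cls x = cls y"
  then have "D x y = \<Delta> (cls y) (cls y)"
    using assms \<Delta>_cls[of x y] by simp
  then show "D x y = 0"
    by (simp add: \<Delta>_def D_refl)
next
  assume 0: "D x y = 0"
  have "D x z = D y z" for z
    by (rule D_eq_of_zero[OF 0 D_refl])
  then show "cls x = cls y"
    by (simp add: cls_def)
qed

lemma \<alpha>_cls: "x \<in> X \<Longrightarrow> \<alpha> (cls x) = cls (f x)"
  using D_zero_fn[OF rep_cls(2), of x 1] by (simp add: \<alpha>_def cls_eq rep_cls D_sym)

lemma \<alpha>n_cls: "x \<in> X \<Longrightarrow> (\<alpha> ^^ n) (cls x) = cls ((f ^^ n) x)"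
  by (induction n) (auto simp: \<alpha>_cls)

lemma Y_metric: "Metric_space Y \<Delta>"
proof
  show "0 \<le> \<Delta> P Q" "\<Delta> P Q = \<Delta> Q P" for P Q
    by (auto simp: \<Delta>_def D_nonneg D_sym)
  show "\<Delta> P Q = 0 \<longleftrightarrow> P = Q" if "P \<in> Y" "Q \<in> Y" for P Q
    using that by (auto simp: Y_def \<Delta>_cls simp flip: cls_eq)
  show "\<Delta> P R \<le> \<Delta> P Q + \<Delta> Q R" for P Q R
    by (simp add: \<Delta>_def D_triangle)
qed

lemma continuous_cls: "continuous_map mtopology (Metric_space.mtopology Y \<Delta>) cls"
  unfolding metric_continuous_map[OF Y_metric]
proof (intro conjI ballI allI impI)
  show "cls ` X \<subseteq> Y"
    by (simp add: Y_def)
  fix a and \<epsilon> :: real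
  assume a: "a \<in> X" and \<epsilon>: "0 < \<epsilon>"
  then have "0 < \<epsilon> / 2"
    by simp
  then obtain \<delta> where \<delta>: "0 < \<delta>" "\<And>x y. \<lbrakk>x \<in> X; y \<in> X; d x y \<le> \<delta>\<rbrakk> \<Longrightarrow> D x y \<le> \<epsilon> / 2"
    using D_uniform by metis
  have "\<Delta> (cls a) (cls x) < \<epsilon>" if "x \<in> X \<and> d a x < \<delta>" for x
    using \<delta>(2)[of a x] a that \<epsilon> by (simp add: \<Delta>_cls)
  then show "\<exists>\<delta>>0. \<forall>x. x \<in> X \<and> d a x < \<delta> \<longrightarrow> \<Delta> (cls a) (cls x) < \<epsilon>"
    using \<delta>(1) by blast
qed

lemma Y_compact_metric: "compact_metric Y \<Delta>"
proof -
  interpret Y: Metric_space Y \<Delta>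
    by (rule Y_metric)
  have "compactin Y.mtopology (cls ` X)"
    using image_compactin[OF _ continuous_cls] compact by (simp add: compact_space_def)
  then show ?thesis
    using Y_metric by (simp add: compact_metric_def compact_space_def flip: Y_def)
qed

lemma \<alpha>_surj: "\<alpha> ` Y = Y"
proof -
  have "\<alpha> ` Y = (\<lambda>x. cls (f x)) ` X"
    by (auto simp: Y_def \<alpha>_cls image_image)
  also have "\<dots> = cls ` f ` X"
    by (simp add: image_image)
  also have "f ` X = X"
    using bij by (simp add: bij_betw_def)
  finally show ?thesis
    by (simp add: Y_def)
qed

text \<open>By \<open>D_fn\<close> with \<open>m = 1\<close>, the map \<open>\<alpha>\<close> is
  Lipschitz with constant \<open>1 / l\<close>.\<close>

lemma continuous_\<alpha>: "continuous_map (Metric_space.mtopology Y \<Delta>) (Metric_space.mtopology Y \<Delta>) \<alpha>"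
proof -
  interpret Y: Metric_space Y \<Delta>
    by (rule Y_metric)
  show ?thesis
    unfolding Y.metric_continuous_map[OF Y_metric]
  proof (intro conjI ballI allI impI)
    show "\<alpha> ` Y \<subseteq> Y"
      by (simp add: \<alpha>_surj)
    fix P and \<epsilon> :: real
    assume P: "P \<in> Y" and \<epsilon>: "0 < \<epsilon>"
    have "\<Delta> (\<alpha> P) (\<alpha> Q) < \<epsilon>" if Q: "Q \<in> Y \<and> \<Delta> P Q < l * \<epsilon>" for Q
    proof -
      obtain x y where xy: "x \<in> X" "P = cls x" "y \<in> X" "Q = cls y"
        using P Q by (auto simp: Y_def)
      have "l * D (f x) (f y) \<le> D x y"
        using D_fn[of 1 x y] by simp
      also have "\<dots> < l * \<epsilon>"
        using Q xy by (simp add: \<Delta>_cls)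
      finally show ?thesis
        using xy const_bounds by (simp add: \<alpha>_cls \<Delta>_cls)
    qed
    then show "\<exists>\<delta>>0. \<forall>Q. Q \<in> Y \<and> \<Delta> P Q < \<delta> \<longrightarrow> \<Delta> (\<alpha> P) (\<alpha> Q) < \<epsilon>"
      using \<epsilon> const_bounds by (intro exI[of _ "l * \<epsilon>"]) auto
  qed
qed

text \<open>On classes, \<open>D\<close>-distance 0 becomes equality, which turns the second
  conclusion of \<open>adapted_axioms\<close> into the inclusion of images in Axiom 2.\<close>

lemma quotient_axioms:
  obtains \<beta> K \<gamma> where "satisfies_axioms Y \<Delta> \<alpha> \<beta> K \<gamma>"
proof -
  obtain \<beta> \<gamma> and K :: nat where bounds: "0 < \<beta>" "1 \<le> K" "0 < \<gamma>" "\<gamma> < 1"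
    and 1: "\<And>x y. \<lbrakk>x \<in> X; y \<in> X; D x y \<le> \<beta>\<rbrakk> \<Longrightarrow>
      D ((f ^^ K) x) ((f ^^ K) y) \<le> \<gamma> ^ K * D ((f ^^ (2 * K)) x) ((f ^^ (2 * K)) y)"
    and 2: "\<And>x w \<epsilon>. \<lbrakk>x \<in> X; w \<in> X; \<epsilon> \<le> \<beta>; D ((f ^^ K) x) w \<le> \<epsilon>\<rbrakk> \<Longrightarrow>
      \<exists>v\<in>X. D x v \<le> \<gamma> * \<epsilon> \<and> D ((f ^^ (2 * K)) v) ((f ^^ K) w) = 0"
    by (rule adapted_axioms) blast
  interpret Y: Metric_space Y \<Delta>
    by (rule Y_metric)
  have "axiom1 Y \<Delta> \<alpha> \<beta> K \<gamma>"
    unfolding axiom1_def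
  proof (intro ballI impI)
    fix P Q
    assume "P \<in> Y" "Q \<in> Y" and PQ: "\<Delta> P Q \<le> \<beta>"
    then obtain x y where xy: "x \<in> X" "P = cls x" "y \<in> X" "Q = cls y"
      by (auto simp: Y_def)
    then show "\<Delta> ((\<alpha> ^^ K) P) ((\<alpha> ^^ K) Q) \<le> \<gamma> ^ K * \<Delta> ((\<alpha> ^^ (2 * K)) P) ((\<alpha> ^^ (2 * K)) Q)"
      using 1[of x y] PQ by (simp add: \<alpha>n_cls \<Delta>_cls)
  qed
  moreover have "axiom2 Y \<Delta> \<alpha> \<beta> K \<gamma>"
    unfolding axiom2_def
  proof (intro ballI allI impI subsetI)
    fix P \<epsilon> R
    assume P: "P \<in> Y" and \<epsilon>: "0 < \<epsilon> \<and> \<epsilon> \<le> \<beta>" and R: "R \<in> (\<alpha> ^^ K) ` Y.mcball ((\<alpha> ^^ K) P) \<epsilon>"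
    obtain x where x: "x \<in> X" "P = cls x"
      using P by (auto simp: Y_def)
    obtain W where W: "W \<in> Y" "\<Delta> ((\<alpha> ^^ K) P) W \<le> \<epsilon>" "R = (\<alpha> ^^ K) W"
      using R by auto
    then obtain w where w: "w \<in> X" "W = cls w"
      by (auto simp: Y_def)
    obtain v where v: "v \<in> X" "D x v \<le> \<gamma> * \<epsilon>" "D ((f ^^ (2 * K)) v) ((f ^^ K) w) = 0"
      using 2[of x w \<epsilon>] x w W \<epsilon> by (auto simp: \<alpha>n_cls \<Delta>_cls)
    have "R = (\<alpha> ^^ (2 * K)) (cls v)"
      using v w W by (simp add: \<alpha>n_cls cls_eq D_sym)
    moreover have "cls v \<in> Y"
      using v by (simp add: Y_def)
    then have "cls v \<in> Y.mcball P (\<gamma> * \<epsilon>)"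
      using P x v by (simp add: \<Delta>_cls)
    ultimately show "R \<in> (\<alpha> ^^ (2 * K)) ` Y.mcball P (\<gamma> * \<epsilon>)"
      by blast
  qed
  ultimately show ?thesis
    using that bounds by (simp add: satisfies_axioms_def)
qed

section \<open>The conjugacy with the inverse limit\<close>

abbreviation "Yhat \<equiv> inverse_limit Y \<alpha>"
abbreviation "\<alpha>hat \<equiv> inverse_limit_map \<alpha>"

lemma \<omega>_in: "x \<in> X \<Longrightarrow> \<omega> x \<in> Yhat"
  by (auto simp: inverse_limit_def \<omega>_def Y_def \<alpha>_cls)

lemma \<omega>_f:
  assumes "x \<in> X"
  shows "\<omega> (f x) = \<alpha>hat (\<omega> x)"
proof
  fix n
  have "(F ^^ n) (f x) = f ((F ^^ n) x)"
    using assms Fm_fn[of "(F ^^ n) x" 0 0] fm_Fn[of "f x" 1 "Suc n"] by (simp add: funpow_swap1)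
  then show "\<omega> (f x) n = \<alpha>hat (\<omega> x) n"
    using assms by (simp add: inverse_limit_map_def \<omega>_def \<alpha>_cls)
qed

text \<open>Translates the inverse iterates that occur in \<open>inverse_limit_dist\<close> into
  iterates of \<open>F\<close> on \<open>X\<close>.\<close>

lemma \<omega>_F:
  assumes "x \<in> X"
  shows "(inv_into Yhat \<alpha>hat ^^ k) (\<omega> x) = \<omega> ((F ^^ k) x)"
proof (induction k)
  case (Suc k)
  let ?x = "(F ^^ k) x"
  have x: "?x \<in> X"
    using assms by simp
  have "inv_into Yhat \<alpha>hat (\<omega> ?x) = inv_into Yhat \<alpha>hat (\<alpha>hat (\<omega> (F ?x)))"
    using \<omega>_f[of "F ?x"] x by simp
  also have "\<dots> = \<omega> (F ?x)"
    using inverse_limit_map_bij[OF \<alpha>_surj] \<omega>_in x by (intro inv_into_f_f) (auto simp: bij_betw_def)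
  finally show ?case
    using Suc by simp
qed simp

text \<open>Equal images put \<open>(F ^^ n) x\<close> and \<open>(F ^^ n) y\<close> on a common
  local stable set for every \<open>n\<close>; contracting forward by \<open>n\<close> steps bounds
  \<open>d x y\<close> by \<open>l ^ n * e'\<close>.\<close>

lemma \<omega>_inj: "inj_on \<omega> X"
proof (rule inj_onI)
  fix x y
  assume x: "x \<in> X" and y: "y \<in> X" and eq: "\<omega> x = \<omega> y"
  have "d x y \<le> l ^ n * e'" for n
  proof -
    let ?x = "(F ^^ n) x" and ?y = "(F ^^ n) y"
    have "D ?x ?y = 0"
      using x y fun_cong[OF eq, of n] by (simp add: \<omega>_def cls_eq)
    then have "?y \<in> S ?x (min e e')"
      using x y by (intro D_zero_stable) auto
    then have st: "?y \<in> S ?x e'"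
      by (rule S_mono) simp
    have "d x y \<le> l ^ n * d ?x ?y"
      using S_contract[OF _ st, of n] x y by simp
    also have "\<dots> \<le> l ^ n * e'"
      using S_dist0[OF st] l_power[of n] by (intro mult_left_mono) auto
    finally show ?thesis .
  qed
  moreover have "(\<lambda>n. l ^ n * e') \<longlonglongrightarrow> 0 * e'"
    using const_bounds by (intro tendsto_intros LIMSEQ_power_zero) auto
  ultimately have "d x y \<le> 0"
    using LIMSEQ_le_const[of "\<lambda>n. l ^ n * e'" 0 "d x y"] by simp
  then show "x = y"
    using x y by (metis antisym nonneg zero)
qed

text \<open>Choose \<open>u n\<close> in the class \<open>p n\<close> and move it to time 0 by
  \<open>f ^^ n\<close>. For \<open>n \<ge> m\<close> the point obtained has its \<open>m\<close>-th
  preimage in the class \<open>p m\<close>. An accumulation point keeps this property for every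
  \<open>m\<close>, because \<open>D\<close> is continuous.\<close>

lemma \<omega>_surj: "\<omega> ` X = Yhat"
proof
  show "\<omega> ` X \<subseteq> Yhat"
    using \<omega>_in by blast
  show "Yhat \<subseteq> \<omega> ` X"
  proof
    fix p assume p: "p \<in> Yhat"
    then have pY: "p n \<in> Y" and p\<alpha>: "p n = \<alpha> (p (Suc n))" for n
      unfolding inverse_limit_def by blast+
    have "\<forall>n. \<exists>x. x \<in> X \<and> p n = cls x"
      using pY unfolding Y_def by blast
    then obtain u where u: "\<And>n. u n \<in> X" "\<And>n. p n = cls (u n)"
      by metis
    have pk: "p n = (\<alpha> ^^ k) (p (n + k))" for n k
    proof (induction k)
      case (Suc k)
      have "p (n + k) = \<alpha> (p (n + Suc k))"
        using p\<alpha>[of "n + k"] by simp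
      then show ?case
        using Suc by (simp add: funpow_swap1)
    qed simp
    define v where "v n = (f ^^ n) (u n)" for n
    have v: "v n \<in> X" for n
      using u by (simp add: v_def)
    obtain x t where t: "x \<in> X" "strict_mono (t :: nat \<Rightarrow> nat)" "(\<lambda>n. d (v (t n)) x) \<longlonglongrightarrow> 0"
      by (rule compact_subseq[OF compact v])
    have "\<omega> x m = p m" for m
    proof -
      have D0: "D ((F ^^ m) (v n)) (u m) = 0" if "m \<le> n" for n
      proof -
        have "p m = cls ((f ^^ (n - m)) (u n))"
          using pk[of m "n - m"] that u by (simp add: \<alpha>n_cls)
        then have "D ((f ^^ (n - m)) (u n)) (u m) = 0"
          using u cls_eq by (metis fn_in)
        then show ?thesis
          using that u by (simp add: v_def Fm_fn)
      qed
      have "(\<lambda>n. D ((F ^^ m) (v (t n))) (u m)) \<longlonglongrightarrow> D ((F ^^ m) x) (u m)"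
        using u v t tendsto_F[OF t(1) v t(3)] by (intro D_tendsto2) auto
      moreover have "\<forall>\<^sub>F n in sequentially. D ((F ^^ m) (v (t n))) (u m) = 0"
        unfolding eventually_sequentially
        using D0 seq_suble[OF t(2)] order_trans by blast
      ultimately have "D ((F ^^ m) x) (u m) = 0"
        by (metis tendsto_eventually LIMSEQ_unique)
      then show ?thesis
        using t u by (simp add: \<omega>_def cls_eq)
    qed
    then have "p = \<omega> x"
      by auto
    then show "p \<in> \<omega> ` X"
      using t by blast
  qed
qed

text \<open>The splitting used for \<open>D_uniform\<close>, now with weights
  \<open>\<gamma> ^ n\<close> and backward iterates: late coordinates are damped by the weight, and
  finitely many early ones by uniform continuity of the iterates of \<open>F\<close>.\<close>

lemma predist_\<omega>_uniform:
  assumes "0 < \<gamma>" "\<gamma> < 1" "0 < \<epsilon>"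
  obtains \<delta> where "0 < \<delta>" "\<And>x y. \<lbrakk>x \<in> X; y \<in> X; d x y \<le> \<delta>\<rbrakk> \<Longrightarrow> inverse_limit_predist Y \<Delta> \<alpha> \<gamma> (\<omega> x) (\<omega> y) \<le> \<epsilon>"
proof -
  have D_le: "D x y \<le> B" for x y
  proof (rule D_least)
    show "l ^ n * g ((f ^^ n) x) ((f ^^ n) y) \<le> B" for n
      using D_term_le[of n x y] mult_left_le_one_le[OF B, of "l ^ n"] l_power[of n] by linarith
  qed
  obtain N where "\<gamma> ^ N < \<epsilon> / (B + 1)"
    using real_arch_pow_inv[of "\<epsilon> / (B + 1)" \<gamma>] assms B by auto
  then have N: "\<gamma> ^ N * (B + 1) < \<epsilon>"
    using B by (simp add: field_simps)
  obtain \<delta>1 where \<delta>1: "0 < \<delta>1" "\<And>x y. \<lbrakk>x \<in> X; y \<in> X; d x y \<le> \<delta>1\<rbrakk> \<Longrightarrow> D x y \<le> \<epsilon>"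
    by (rule D_uniform[OF assms(3)]) blast
  obtain \<delta> where \<delta>: "0 < \<delta>" "\<And>x y j. \<lbrakk>x \<in> X; y \<in> X; d x y \<le> \<delta>; j \<le> N\<rbrakk> \<Longrightarrow> d ((F ^^ j) x) ((F ^^ j) y) \<le> \<delta>1"
    by (rule uniform_F[OF \<delta>1(1)]) blast
  have "inverse_limit_predist Y \<Delta> \<alpha> \<gamma> (\<omega> x) (\<omega> y) \<le> \<epsilon>" if xy: "x \<in> X" "y \<in> X" "d x y \<le> \<delta>" for x y
  proof -
    have "\<gamma> ^ n * \<Delta> (\<omega> x n) (\<omega> y n) \<le> \<epsilon>" for n
    proof -
      let ?D = "D ((F ^^ n) x) ((F ^^ n) y)"
      have "\<gamma> ^ n * ?D \<le> \<epsilon>"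
      proof (cases "n \<le> N")
        case True
        then have "?D \<le> \<epsilon>"
          using \<delta>1(2) \<delta>(2) xy by simp
        moreover have "\<gamma> ^ n * ?D \<le> ?D"
          using assms D_nonneg by (intro mult_left_le_one_le) (auto simp: power_le_one)
        ultimately show ?thesis
          by linarith
      next
        case False
        then have "\<gamma> ^ n * ?D \<le> \<gamma> ^ N * (B + 1)"
          using assms B D_nonneg order_trans[OF D_le, of "B + 1"] by (intro mult_mono power_decreasing) auto
        then show ?thesis
          using N by linarith
      qed
      then show ?thesis
        using xy by (simp add: \<omega>_def \<Delta>_cls)
    qed
    then show ?thesis
      using \<omega>_in xy by (auto simp: inverse_limit_predist_def intro!: cSUP_least)
  qed
  then show ?thesis
    using that \<delta>(1) by blast
qed

text \<open>A continuous bijection from a compact space onto a Hausdorff space is a homeomorphism,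
  so it remains to show that \<open>\<omega>\<close> is continuous. The metric is a finite weighted
  sum, and each summand is handled by \<open>predist_\<omega>_uniform\<close> at the points shifted
  by \<open>F ^^ k\<close>.\<close>

lemma conjugacy:
  assumes K: "1 \<le> K" and \<gamma>: "0 < \<gamma>" "\<gamma> < 1"
  shows "topologically_conjugate mtopology f
    (Metric_space.mtopology Yhat (inverse_limit_dist Y \<Delta> \<alpha> K \<gamma>)) \<alpha>hat"
proof -
  let ?\<rho> = "inverse_limit_dist Y \<Delta> \<alpha> K \<gamma>"
  have metric: "Metric_space Yhat ?\<rho>"
    by (rule inverse_limit_dist_metric[OF Y_compact_metric \<alpha>_surj K \<gamma>])
  interpret L: Metric_space Yhat ?\<rho>
    by (rule metric)
  have "continuous_map mtopology L.mtopology \<omega>"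
    unfolding metric_continuous_map[OF metric]
  proof (intro conjI ballI allI impI)
    show "\<omega> ` X \<subseteq> Yhat"
      by (simp add: \<omega>_surj)
    fix a and \<epsilon> :: real
    assume a: "a \<in> X" and \<epsilon>: "0 < \<epsilon>"
    define c where "c = (\<Sum>k<K. inverse \<gamma> ^ k)"
    have c: "0 \<le> c"
      using \<gamma> by (auto simp: c_def intro!: sum_nonneg)
    \<comment> \<open>\<open>c\<close> is the total weight of the \<open>K\<close> summands; the
      divisor is chosen to make \<open>c * \<epsilon>'\<close> strictly smaller than
      \<open>\<epsilon>\<close>.\<close>
    define \<epsilon>' where "\<epsilon>' = \<epsilon> / (2 * (c + 1))"
    have \<epsilon>': "0 < \<epsilon>'" "c * \<epsilon>' < \<epsilon>"
      using c \<epsilon> by (auto simp: \<epsilon>'_def field_simps intro: add_nonneg_pos)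
    obtain \<delta>1 where \<delta>1: "0 < \<delta>1" "\<And>x y. \<lbrakk>x \<in> X; y \<in> X; d x y \<le> \<delta>1\<rbrakk> \<Longrightarrow> inverse_limit_predist Y \<Delta> \<alpha> \<gamma> (\<omega> x) (\<omega> y) \<le> \<epsilon>'"
      by (rule predist_\<omega>_uniform[OF \<gamma> \<epsilon>'(1)]) blast
    obtain \<delta> where \<delta>: "0 < \<delta>" "\<And>x y j. \<lbrakk>x \<in> X; y \<in> X; d x y \<le> \<delta>; j \<le> K\<rbrakk> \<Longrightarrow> d ((F ^^ j) x) ((F ^^ j) y) \<le> \<delta>1"
      by (rule uniform_F[OF \<delta>1(1)]) blast
    have "?\<rho> (\<omega> a) (\<omega> x) < \<epsilon>" if x: "x \<in> X \<and> d a x < \<delta>" for x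
    proof -
      have "?\<rho> (\<omega> a) (\<omega> x) \<le> (\<Sum>k<K. inverse \<gamma> ^ k * \<epsilon>')"
        unfolding inverse_limit_dist_def
      proof (rule sum_mono)
        fix k assume "k \<in> {..<K}"
        then have "inverse_limit_predist Y \<Delta> \<alpha> \<gamma> (\<omega> ((F ^^ k) a)) (\<omega> ((F ^^ k) x)) \<le> \<epsilon>'"
          using a x \<delta>(2) by (intro \<delta>1(2)) auto
        then show "inverse \<gamma> ^ k * inverse_limit_predist Y \<Delta> \<alpha> \<gamma>
            ((inv_into Yhat \<alpha>hat ^^ k) (\<omega> a)) ((inv_into Yhat \<alpha>hat ^^ k) (\<omega> x)) \<le> inverse \<gamma> ^ k * \<epsilon>'"
          using a x \<gamma> by (intro mult_left_mono) (auto simp: \<omega>_F)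
      qed
      also have "\<dots> = c * \<epsilon>'"
        by (simp add: c_def sum_distrib_right)
      finally show ?thesis
        using \<epsilon>' by linarith
    qed
    then show "\<exists>\<delta>>0. \<forall>x. x \<in> X \<and> d a x < \<delta> \<longrightarrow> ?\<rho> (\<omega> a) (\<omega> x) < \<epsilon>"
      using \<delta>(1) by blast
  qed
  then have "homeomorphic_map mtopology L.mtopology \<omega>"
    using compact L.Hausdorff_space_mtopology \<omega>_surj \<omega>_inj
    by (intro continuous_imp_homeomorphic_map) auto
  then show ?thesis
    using \<omega>_f by (auto simp: topologically_conjugate_def)
qed

end

theorem theoremB:
  fixes X :: "'a set" and d :: "'a \<Rightarrow> 'a \<Rightarrow> real" and f :: "'a \<Rightarrow> 'a"
    and e e' l :: real
  assumes "smale_space X d f e e' l"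
    and "totally_disconnected_local_stable X d f e"
    and "irreducible_system X d f"
  shows "\<exists>(Y :: 'a set set) \<delta> \<alpha> \<beta> K \<gamma>.
      compact_metric Y \<delta> \<and>
      continuous_map (Metric_space.mtopology Y \<delta>) (Metric_space.mtopology Y \<delta>) \<alpha> \<and>
      \<alpha> ` Y = Y \<and>
      satisfies_axioms Y \<delta> \<alpha> \<beta> K \<gamma> \<and>
      topologically_conjugate (Metric_space.mtopology X d) f
        (Metric_space.mtopology (inverse_limit Y \<alpha>) (inverse_limit_dist Y \<delta> \<alpha> K \<gamma>))
        (inverse_limit_map \<alpha>)"
proof -
  interpret smale X d f e e' l
    using assms(1) by (rule smale.intro)
  obtain g \<eta> B L where "transverse X d f e e' l g \<eta> B L"
    using transverse_ex[OF assms(2)] by blast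
  then interpret transverse X d f e e' l g \<eta> B L .
  obtain \<beta> K \<gamma> where ax: "satisfies_axioms Y \<Delta> \<alpha> \<beta> K \<gamma>"
    by (rule quotient_axioms)
  then have "topologically_conjugate mtopology f (Metric_space.mtopology Yhat (inverse_limit_dist Y \<Delta> \<alpha> K \<gamma>)) \<alpha>hat"
    by (intro conjugacy) (simp_all add: satisfies_axioms_def)
  with ax Y_compact_metric continuous_\<alpha> \<alpha>_surj show ?thesis
    by blast
qed

end
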